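(* Let $H\le F$ be a non-trivial subgroup, let $T$ be a geodesic spanning tree (with respect to $o=H$) of the Schreier graph $X=H\backslash F$, and let $\Omega$ be the associated Schreier limit set. Let $\Lambda^{horS}$ and $\Lambda^{horB}$ be the small and big horospheric limit sets of $H$, and let $$\Sigma=\Bigl\{\omega\in\partial F:\ \sum_{h\in H}(2m-1)^{-b_\omega(h)}=\infty\Bigr\}.$$ Then the sets $\Lambda^{horS},\Omega,\Lambda^{horB},\Sigma$ all coincide up to subsets of $\mathfrak m$-measure $0$, where $\mathfrak m$ is the uniform measure on $\partial F$.
   Context: $F$ is the free group freely generated by a finite set $\mathcal A$ with $|\mathcal A|=m\ge 2$; $\breve{\mathcal A}=\mathcal A\sqcup\mathcal A^{-1}$. Elements $g\in F$ are identified with finite freely reduced words in $\breve{\mathcal A}$, $|g|$ is the length. $\partial F$ is the set of infinite freely reduced words with the product topology. The uniform measure $\mathfrak m$ is the Borel probability measure on $\partial F$ for which the set of infinite words beginning with $g$ has measure $\frac1{2m(2m-1)^{|g|-1}}$ for every $g\ne e$. Busemann function: for $\omega\in\partial F$, $b_\omega(g)=|g|-2(g|\omega)$, where $(g|\omega)$ is the length of the longest common initial segment of the words $g$ and $\omega$. Horoballs centered at $\omega$ are the sets $\{g'\in F: b_\omega(g')\le b_\omega(g)\}$, $g\in F$. $\Lambda^{horS}$ (resp. $\Lambda^{horB}$) is the set of $\omega\in\partial F$ such that any (resp. a certain) horoball centered at $\omega$ contains infinitely many points of $H$; that is, for any (resp. a certain) $N\in\mathbb Z$ there are infinitely many $h\in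 H$ with $b_\omega(h)\le N$. Schreier limit set: $X=H\backslash F$ has the cosets $Hg$ as vertices and, for each vertex $x$ and $a\in\breve{\mathcal A}$, an oriented edge from $x$ to $xa$ labelled $a$, whose reversal is the edge from $xa$ to $x$ labelled $a^{-1}$ (loops and multiple edges allowed); $o=H$. A spanning tree $T$ is geodesic if $d_T(o,x)=d_X(o,x)$ for all $x$. For every oriented edge $\mathcal E=[x,y]$ of $X$ not in $T$, $s_{\mathcal E}\in H$ is the element read along the path going from $o$ to $x$ in $T$, along $[x,y]$, and from $y$ to $o$ in $T$. The set $\breve{\mathcal S}$ of all $s_{\mathcal E}$ equals $\mathcal S\sqcup\mathcal S^{-1}$ with $\mathcal S$ (edges with label in $\mathcal A$) a free generating set of $H$. For each infinite freely reduced word $\xi=s_1s_2\dots$ in $\breve{\mathcal S}$ the limit $\sigma^\infty(\xi)=\lim_n s_1\cdots s_n\in\partial F$ (pointwise convergence of reduced words in $\breve{\mathcal A}$) exists, and $\Omega$ is the set of all these limits. *)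

theory Defs
  imports
    "HOL-Probability.Probability"
    "HOL-Algebra.Coset"
    "Graph_Theory.Arc_Walk"
begin

section \<open>The free group on a finite alphabet\<close>

text \<open>The alphabet is the type \<open>'a\<close>, so that $m$ is \<open>CARD('a)\<close>; the letter
  \<open>(a, True)\<close> stands for $a$ and \<open>(a, False)\<close> for $a^{-1}$.\<close>

type_synonym 'a letter = "'a \<times> bool"

definition inv_letter :: "'a letter \<Rightarrow> 'a letter" where
  "inv_letter x = (fst x, \<not> snd x)"

definition reduced_word :: "'a letter list \<Rightarrow> bool" where
  "reduced_word w \<longleftrightarrow> successively (\<lambda>x y. y \<noteq> inv_letter x) w"

definition push_letter :: "'a letter \<Rightarrow> 'a letter list \<Rightarrow> 'a letter list" where
  "push_letter x w =
     (case w of [] \<Rightarrow> [x] | y # ys \<Rightarrow> if y = inv_letter x then ys else x # w)"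

definition freely_reduce :: "'a letter list \<Rightarrow> 'a letter list" where
  "freely_reduce w = foldr push_letter w []"

definition free_group :: "'a letter list monoid" where
  "free_group = \<lparr> carrier = {w. reduced_word w},
                  mult = (\<lambda>u v. freely_reduce (u @ v)), one = [] \<rparr>"

lemma inv_letter_simps [simp]:
  "inv_letter (inv_letter x) = x" "inv_letter x \<noteq> x" "x \<noteq> inv_letter x"
  by (auto simp: inv_letter_def prod_eq_iff)

lemma reduced_word_push:
  "reduced_word w \<Longrightarrow> reduced_word (push_letter x w)"
  by (cases w; cases "tl w") (auto simp: reduced_word_def push_letter_def)

lemma reduced_word_foldr:
  "reduced_word w \<Longrightarrow> reduced_word (foldr push_letter u w)"
  by (induction u) (auto simp: reduced_word_push)

lemma reduced_word_freely_reduce: "reduced_word (freely_reduce w)"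
  unfolding freely_reduce_def by (rule reduced_word_foldr) (simp add: reduced_word_def)

lemma freely_reduce_reduced: "reduced_word w \<Longrightarrow> freely_reduce w = w"
proof (induction w)
  case (Cons x w)
  then show ?case
    by (cases w) (auto simp: freely_reduce_def push_letter_def reduced_word_def)
qed (simp add: freely_reduce_def)

lemma push_push_inv:
  "reduced_word w \<Longrightarrow> push_letter x (push_letter (inv_letter x) w) = w"
  by (cases w; cases "tl w") (auto simp: push_letter_def reduced_word_def)

lemma foldr_push_push:
  assumes "reduced_word w"
  shows "foldr push_letter (push_letter x u) w = push_letter x (foldr push_letter u w)"
  using push_push_inv[OF reduced_word_foldr[OF assms]]
  by (cases u) (auto simp: push_letter_def[of x "_ # _"] push_letter_def[of x "[]"])

lemma foldr_push_freely_reduce: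
  assumes "reduced_word w"
  shows "foldr push_letter (freely_reduce u) w = foldr push_letter u w"
  by (induction u) (simp_all add: freely_reduce_def foldr_push_push[OF assms])

lemma freely_reduce_append:
  "freely_reduce (u @ v) = foldr push_letter u (freely_reduce v)"
  by (simp add: freely_reduce_def)

lemma freely_reduce_left: "freely_reduce (freely_reduce u @ v) = freely_reduce (u @ v)"
  by (simp add: freely_reduce_append foldr_push_freely_reduce reduced_word_freely_reduce)

lemma freely_reduce_right: "freely_reduce (u @ freely_reduce v) = freely_reduce (u @ v)"
  by (simp add: freely_reduce_append freely_reduce_reduced reduced_word_freely_reduce)

lemma freely_reduce_inverse: "freely_reduce (rev (map inv_letter w) @ w) = []"
proof (induction w)
  case (Cons x w)
  have "push_letter (inv_letter x) (push_letter x (freely_reduce w)) = freely_reduce w"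
    using push_push_inv[OF reduced_word_freely_reduce, of "inv_letter x" w] by simp
  then show ?case
    using Cons by (simp add: freely_reduce_append) (simp add: freely_reduce_def)
qed (simp add: freely_reduce_def)

lemma group_free_group: "group free_group"
proof (rule groupI)
  fix x :: "'a letter list" assume "x \<in> carrier free_group"
  have "freely_reduce (freely_reduce (rev (map inv_letter x)) @ x) = []"
    by (simp add: freely_reduce_left freely_reduce_inverse)
  then show "\<exists>y\<in>carrier free_group. y \<otimes>\<^bsub>free_group\<^esub> x = \<one>\<^bsub>free_group\<^esub>"
    by (intro bexI[of _ "freely_reduce (rev (map inv_letter x))"])
       (simp_all add: free_group_def reduced_word_freely_reduce)
qed (simp_all add: free_group_def reduced_word_freely_reduce freely_reduce_reduced
      freely_reduce_left freely_reduce_right, simp add: reduced_word_def)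


section \<open>The boundary and the uniform measure\<close>

definition boundary :: "(nat \<Rightarrow> 'a letter) set" where
  "boundary = {\<omega>. \<forall>n. \<omega> (Suc n) \<noteq> inv_letter (\<omega> n)}"

definition boundary_topology :: "(nat \<Rightarrow> 'a letter) topology" where
  "boundary_topology =
     subtopology (product_topology (\<lambda>_. discrete_topology UNIV) UNIV) boundary"

definition cylinder :: "'a letter list \<Rightarrow> (nat \<Rightarrow> 'a letter) set" where
  "cylinder g = {\<omega> \<in> boundary. \<forall>i<length g. \<omega> i = g ! i}"

text \<open>These conditions determine the measure, because the cylinders form, together with the
  empty set, an intersection-stable generator of the Borel sets.\<close>

definition uniform_measure_on_boundary :: "(nat \<Rightarrow> 'a::finite letter) measure \<Rightarrow> bool" where
  "uniform_measure_on_boundary M \<longleftrightarrow>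
     prob_space M \<and>
     sets M = sets (sigma boundary {U. openin boundary_topology U}) \<and>
     (\<forall>g\<in>carrier free_group. g \<noteq> \<one>\<^bsub>free_group\<^esub> \<longrightarrow>
        measure M (cylinder g) =
          1 / (2 * real CARD('a) * (2 * real CARD('a) - 1) ^ (length g - 1)))"


section \<open>Horospheric limit sets\<close>

definition gromov_product :: "'a letter list \<Rightarrow> (nat \<Rightarrow> 'a letter) \<Rightarrow> nat" where
  "gromov_product g \<omega> = Max {n. n \<le> length g \<and> (\<forall>i<n. g ! i = \<omega> i)}"

definition busemann :: "(nat \<Rightarrow> 'a letter) \<Rightarrow> 'a letter list \<Rightarrow> int" where
  "busemann \<omega> g = int (length g) - 2 * int (gromov_product g \<omega>)"

definition horoball :: "(nat \<Rightarrow> 'a letter) \<Rightarrow> 'a letter list \<Rightarrow> 'a letter list set" where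
  "horoball \<omega> g = {g' \<in> carrier free_group. busemann \<omega> g' \<le> busemann \<omega> g}"

definition small_horospheric :: "'a letter list set \<Rightarrow> (nat \<Rightarrow> 'a letter) set" where
  "small_horospheric H =
     {\<omega> \<in> boundary. \<forall>g\<in>carrier free_group. infinite (H \<inter> horoball \<omega> g)}"

definition big_horospheric :: "'a letter list set \<Rightarrow> (nat \<Rightarrow> 'a letter) set" where
  "big_horospheric H =
     {\<omega> \<in> boundary. \<exists>g\<in>carrier free_group. infinite (H \<inter> horoball \<omega> g)}"

definition poincare_divergence :: "'a::finite letter list set \<Rightarrow> (nat \<Rightarrow> 'a letter) set" where
  "poincare_divergence H =
     {\<omega> \<in> boundary.
        (\<Sum>\<^sub>\<infinity>h\<in>H. ennreal ((2 * real CARD('a) - 1) powi (- busemann \<omega> h))) = \<infinity>}"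


section \<open>Schreier graphs and geodesic spanning trees\<close>

text \<open>The oriented edge labelled \<open>a\<close> issued from the coset \<open>x\<close> is the pair \<open>(x, a)\<close>.\<close>

type_synonym 'a coset = "'a letter list set"
type_synonym 'a edge = "'a coset \<times> 'a letter"

definition schreier_graph :: "'a letter list set \<Rightarrow> ('a coset, 'a edge) pre_digraph" where
  "schreier_graph H =
     \<lparr> verts = rcosets\<^bsub>free_group\<^esub> H,
       arcs = (rcosets\<^bsub>free_group\<^esub> H) \<times> UNIV,
       tail = fst,
       head = (\<lambda>(x, a). x #>\<^bsub>free_group\<^esub> [a]) \<rparr>"

definition reverse_edge :: "'a edge \<Rightarrow> 'a edge" where
  "reverse_edge = (\<lambda>(x, a). (x #>\<^bsub>free_group\<^esub> [a], inv_letter a))"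

text \<open>A subgraph on all vertices is given by its set \<open>T\<close> of oriented edges.\<close>

definition edge_subgraph :: "'a letter list set \<Rightarrow> 'a edge set \<Rightarrow> ('a coset, 'a edge) pre_digraph"
  where "edge_subgraph H T = (schreier_graph H)\<lparr> arcs := T \<rparr>"

text \<open>In a graph whose edges come in mutually reverse pairs, \<^const>\<open>pre_digraph.cycle\<close> also
  holds of an edge followed by its reversal. This is not a circuit of the underlying unoriented
  graph, whence the condition on successive edges.\<close>

definition spanning_tree :: "'a letter list set \<Rightarrow> 'a edge set \<Rightarrow> bool" where
  "spanning_tree H T \<longleftrightarrow>
     T \<subseteq> arcs (schreier_graph H) \<and> reverse_edge ` T \<subseteq> T \<and>
     (\<forall>u\<in>verts (schreier_graph H). \<forall>v\<in>verts (schreier_graph H).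
        \<exists>p. pre_digraph.awalk (edge_subgraph H T) u p v) \<and>
     \<not> (\<exists>p. pre_digraph.cycle (edge_subgraph H T) p \<and>
            successively (\<lambda>e f. f \<noteq> reverse_edge e) p)"

text \<open>Only used for vertices joined by a path, as are all vertices of a Schreier graph and of a
  spanning tree.\<close>

definition graph_dist :: "('v, 'e) pre_digraph \<Rightarrow> 'v \<Rightarrow> 'v \<Rightarrow> nat" where
  "graph_dist G u v = (LEAST n. \<exists>p. pre_digraph.awalk G u p v \<and> length p = n)"

text \<open>The base vertex \<open>o\<close> is the coset \<open>H\<close> itself.\<close>

definition geodesic_spanning_tree :: "'a letter list set \<Rightarrow> 'a edge set \<Rightarrow> bool" where
  "geodesic_spanning_tree H T \<longleftrightarrow>
     spanning_tree H T \<and>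
     (\<forall>x\<in>verts (schreier_graph H).
        graph_dist (edge_subgraph H T) H x = graph_dist (schreier_graph H) H x)"


section \<open>The Schreier limit set\<close>

definition tree_path :: "'a letter list set \<Rightarrow> 'a edge set \<Rightarrow> 'a coset \<Rightarrow> 'a coset \<Rightarrow> 'a edge list"
  where "tree_path H T u v = (THE p. pre_digraph.apath (edge_subgraph H T) u p v)"

definition schreier_generator ::
    "'a letter list set \<Rightarrow> 'a edge set \<Rightarrow> 'a edge \<Rightarrow> 'a letter list" where
  "schreier_generator H T e =
     freely_reduce (map snd
       (tree_path H T H (tail (schreier_graph H) e) @ [e] @
        tree_path H T (head (schreier_graph H) e) H))"

definition schreier_generators :: "'a letter list set \<Rightarrow> 'a edge set \<Rightarrow> 'a letter list set" where
  "schreier_generators H T = schreier_generator H T ` (arcs (schreier_graph H) - T)"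

text \<open>\<^const>\<open>schreier_generators\<close> is the symmetrized generating set, and \<open>s\<close> and
  \<open>s\<inverse>\<close> are distinct there, so that \<open>s\<inverse>\<close> as a letter is the inverse in the group.\<close>

definition reduced_generator_words ::
    "'a letter list set \<Rightarrow> 'a edge set \<Rightarrow> (nat \<Rightarrow> 'a letter list) set" where
  "reduced_generator_words H T =
     {\<xi>. (\<forall>n. \<xi> n \<in> schreier_generators H T) \<and>
          (\<forall>n. \<xi> (Suc n) \<noteq> inv\<^bsub>free_group\<^esub> (\<xi> n))}"

primrec partial_product :: "(nat \<Rightarrow> 'a letter list) \<Rightarrow> nat \<Rightarrow> 'a letter list" where
  "partial_product \<xi> 0 = \<one>\<^bsub>free_group\<^esub>"
| "partial_product \<xi> (Suc n) = partial_product \<xi> n \<otimes>\<^bsub>free_group\<^esub> \<xi> n"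

definition words_converge :: "(nat \<Rightarrow> 'a letter list) \<Rightarrow> (nat \<Rightarrow> 'a letter) \<Rightarrow> bool" where
  "words_converge w \<omega> \<longleftrightarrow>
     (\<forall>k. \<forall>\<^sub>F n in sequentially. k < length (w n) \<and> w n ! k = \<omega> k)"

definition schreier_limit_set ::
    "'a letter list set \<Rightarrow> 'a edge set \<Rightarrow> (nat \<Rightarrow> 'a letter) set" where
  "schreier_limit_set H T =
     {\<omega> \<in> boundary. \<exists>\<xi>\<in>reduced_generator_words H T. words_converge (partial_product \<xi>) \<omega>}"

end

theory Submission
  imports Defs
begin

text \<open>
  Read a boundary point \<open>\<omega>\<close> as an infinite path without backtracking in the Schreier graph,
  starting at the origin. Let \<open>x\<^sub>n\<close> be its vertex at time \<open>n\<close> and \<open>D\<^sub>n = n - d(o, x\<^sub>n)\<close>,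
  which is nondecreasing. Closing the path by a geodesic from \<open>x\<^sub>n\<close> to \<open>o\<close> gives an \<open>h \<in> H\<close> with
  \<open>b\<^sub>\<omega>(h) \<le> - D\<^sub>n\<close>, and no element of length at most \<open>n\<close> does better, so \<open>\<omega>\<close> is small
  horospheric iff \<open>D\<^sub>n\<close> is unbounded. By Reidemeister--Schreier rewriting, \<open>\<omega>\<close> lies in the Schreier
  limit set iff the path crosses infinitely many edges outside \<open>T\<close>. As \<open>T\<close> is geodesic, a path that
  is eventually in \<open>T\<close> has bounded \<open>D\<^sub>n\<close>; hence small horospheric points lie in the Schreier limit set.

  If \<open>D\<^sub>n\<close> is bounded, the path eventually moves away from the origin at each step. Each time it
  does so along an edge outside \<open>T\<close>, the tree edge towards the origin is available as the next step
  and has conditional probability \<open>1 / (2m - 1)\<close>. Almost surely, this cannot be avoided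
  infinitely often, so almost every point of the Schreier limit set is small horospheric.

  A point outside the Schreier limit set eventually follows a tree ray. On the set \<open>\<Delta>\<close> of
  points with a given initial word followed by a tree ray, \<open>(2m - 1)\<close> to the power \<open>- b\<^sub>\<omega>(h)\<close> is the Jacobian of the
  translation by the inverse of \<open>h\<close>. The translates of \<open>\<Delta>\<close> by \<open>H\<close> are disjoint, so that the
  Poincare series has integral at most \<open>1\<close> over \<open>\<Delta>\<close> and converges almost everywhere there.
\<close>

section \<open>Reduced words\<close>

definition inv_word :: "'a letter list \<Rightarrow> 'a letter list" where
  "inv_word w = rev (map inv_letter w)"

lemma inv_word_simps [simp]:
  "inv_word [] = []" "inv_word (u @ v) = inv_word v @ inv_word u"
  "inv_word (a # w) = inv_word w @ [inv_letter a]" "inv_word (inv_word w) = w"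
  "length (inv_word w) = length w" "inv_word w = [] \<longleftrightarrow> w = []"
  by (auto simp: inv_word_def rev_map o_def)

lemma freely_reduce_Nil [simp]: "freely_reduce [] = []"
  by (simp add: freely_reduce_def)

lemma freely_reduce_Cons: "freely_reduce (a # w) = push_letter a (freely_reduce w)"
  by (simp add: freely_reduce_def)

lemma reduced_word_Nil [simp]: "reduced_word []"
  by (simp add: reduced_word_def)

lemma reduced_word_append:
  "reduced_word (u @ v) \<longleftrightarrow>
     reduced_word u \<and> reduced_word v \<and> (u = [] \<or> v = [] \<or> hd v \<noteq> inv_letter (last u))"
  by (simp add: reduced_word_def successively_append_iff)

lemma reduced_word_singleton [simp]: "reduced_word [a]"
  by (simp add: reduced_word_def)

lemma reduced_inv_word [simp]: "reduced_word (inv_word w) \<longleftrightarrow> reduced_word w"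
proof -
  have *: "reduced_word w \<Longrightarrow> reduced_word (inv_word w)" for w :: "'a letter list"
  proof (induction w)
    case (Cons a w)
    then have "reduced_word w" and "w = [] \<or> hd w \<noteq> inv_letter a"
      using reduced_word_append[of "[a]" w] by auto
    with Cons.IH show ?case
      by (auto simp: reduced_word_append inv_word_def last_rev hd_map)
  qed simp
  show ?thesis using *[of w] *[of "inv_word w"] by auto
qed

lemma freely_reduce_inv_word [simp]:
  "freely_reduce (inv_word w @ w) = []" "freely_reduce (w @ inv_word w) = []"
  using freely_reduce_inverse[of w] freely_reduce_inverse[of "inv_word w"]
  by (simp_all add: inv_word_def[symmetric])

section \<open>Free reduction as a group calculus on words\<close>

lemma freely_reduce_cong:
  assumes "freely_reduce u = freely_reduce u'" "freely_reduce v = freely_reduce v'"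
  shows "freely_reduce (u @ v) = freely_reduce (u' @ v')"
  using assms by (metis freely_reduce_left freely_reduce_right)

lemma freely_reduce_cancel_inv [simp]:
  "freely_reduce (u @ inv_word u @ v) = freely_reduce v"
  "freely_reduce (inv_word u @ u @ v) = freely_reduce v"
  using freely_reduce_left[of "u @ inv_word u" v] freely_reduce_left[of "inv_word u @ u" v]
  by simp_all

text \<open>Multiply both sides by the inverse word, which cancels \<open>u\<close> under free
  reduction.\<close>

lemma freely_reduce_cancel_left:
  assumes "freely_reduce (u @ v) = freely_reduce (u @ v')"
  shows "freely_reduce v = freely_reduce v'"
  using freely_reduce_cong[OF refl assms, of "inv_word u"] by simp

lemma freely_reduce_cancel_right:
  assumes "freely_reduce (u @ v) = freely_reduce (u' @ v)"
  shows "freely_reduce u = freely_reduce u'"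
  using freely_reduce_cong[OF assms refl, of "inv_word v"]
    freely_reduce_right[of u "v @ inv_word v"] freely_reduce_right[of u' "v @ inv_word v"] by simp

lemma freely_reduce_eq_iff_inv:
  "freely_reduce (inv_word u @ v) = [] \<longleftrightarrow> freely_reduce u = freely_reduce v"
  using freely_reduce_cancel_left[of "inv_word u" v u]
  by (metis freely_reduce_cong freely_reduce_inv_word(1))

lemma freely_reduce_inv_cong:
  assumes "freely_reduce u = freely_reduce v"
  shows "freely_reduce (inv_word u) = freely_reduce (inv_word v)"
proof (rule freely_reduce_cancel_left)
  show "freely_reduce (u @ inv_word u) = freely_reduce (u @ inv_word v)"
    using freely_reduce_cong[OF assms refl, of "inv_word v"] by simp
qed

section \<open>Lengths and cancellation in products\<close>

lemma length_push_letter: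
  "length (push_letter a w) \<le> Suc (length w)" "length w \<le> Suc (length (push_letter a w))"
  by (auto simp: push_letter_def split: list.split)

text \<open>Each pushed letter changes the length by at most one, in either direction.\<close>

lemma length_freely_reduce_append:
  "length (freely_reduce (u @ v)) \<le> length u + length (freely_reduce v)"
  "length (freely_reduce v) \<le> length u + length (freely_reduce (u @ v))"
proof (induction u)
  case (Cons a u)
  { case 1 then show ?case using Cons.IH(1) length_push_letter(1)[of a "freely_reduce (u @ v)"]
      by (simp add: freely_reduce_Cons) }
  { case 2 then show ?case using Cons.IH(2) length_push_letter(2)[of "freely_reduce (u @ v)" a]
      by (simp add: freely_reduce_Cons) }
qed simp_all

lemma length_freely_reduce_le: "length (freely_reduce u) \<le> length u"
  using length_freely_reduce_append(1)[of u "[]"] by simp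

text \<open>A cancellation would shorten the word, so none takes place.\<close>

lemma freely_reduce_eq_if_length:
  "length (freely_reduce u) = length u \<Longrightarrow> freely_reduce u = u"
proof (induction u)
  case (Cons a u)
  from Cons.prems have "length (freely_reduce u) = length u"
    using length_push_letter(1)[of a "freely_reduce u"] length_freely_reduce_le[of u]
    by (simp add: freely_reduce_Cons)
  then have "freely_reduce u = u" by (rule Cons.IH)
  then have "freely_reduce (a # u) = push_letter a u" by (simp add: freely_reduce_Cons)
  then show ?case using Cons.prems
    by (cases u) (auto simp: push_letter_def split: if_splits)
qed simp

text \<open>Multiplication on the left by \<open>u\<close> cancels at most \<open>length u\<close>
  letters and so cannot reach beyond \<open>w\<close>. Hence a translation leaves the tails of long
  words unchanged.\<close>

lemma freely_reduce_append_long: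
  assumes "reduced_word (w @ w')" "length u \<le> length w"
  shows "freely_reduce (u @ w @ w') = freely_reduce (u @ w) @ w'"
  using assms(2)
proof (induction u)
  case Nil
  then show ?case using assms(1) by (simp add: freely_reduce_reduced reduced_word_append)
next
  case (Cons a u)
  have "length (freely_reduce w) \<le> length u + length (freely_reduce (u @ w))"
    by (rule length_freely_reduce_append)
  moreover have "freely_reduce w = w" using assms(1) by (simp add: freely_reduce_reduced reduced_word_append)
  \<comment> \<open>Here \<open>w\<close> is strictly longer than \<open>u\<close>, so pushing
    \<open>a\<close> meets a letter in front of \<open>w'\<close>.\<close>
  ultimately have "freely_reduce (u @ w) \<noteq> []" using Cons.prems by auto
  then show ?case using Cons by (cases "freely_reduce (u @ w)") (auto simp: freely_reduce_Cons push_letter_def)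
qed

text \<open>The assumptions make \<open>c\<close> the length of the longest common prefix. It
  cancels, and the remaining words meet without cancellation because their first letters
  differ.\<close>

lemma length_freely_reduce_cancel:
  assumes "reduced_word h" "reduced_word w"
    and "c \<le> length h" "c \<le> length w" "take c h = take c w"
    and "c = length h \<or> c = length w \<or> h ! c \<noteq> w ! c"
  shows "length (freely_reduce (inv_word h @ w)) + 2 * c = length h + length w"
proof -
  define p r s where "p = take c w" and "r = drop c h" and "s = drop c w"
  have h: "h = p @ r" and w: "w = p @ s" using assms(5)
    by (simp_all add: p_def r_def s_def) (metis append_take_drop_id)
  have "reduced_word (inv_word r @ s)"
  proof (cases "r = [] \<or> s = []")
    case False
    then have "hd r \<noteq> hd s" using assms(3,4,6) by (auto simp: r_def s_def hd_drop_conv_nth)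
    moreover have "last (inv_word r) = inv_letter (hd r)" using False by (auto simp: inv_word_def last_rev hd_map)
    ultimately show ?thesis using assms(1,2) by (auto simp: h w reduced_word_append)
  qed (use assms(1,2) in \<open>auto simp: h w reduced_word_append\<close>)
  then have "freely_reduce (inv_word h @ w) = inv_word r @ s"
    using freely_reduce_right[of "inv_word r" "inv_word p @ p @ s"] freely_reduce_right[of "inv_word r" s]
    by (simp add: h w freely_reduce_reduced)
  then show ?thesis using assms(3,4) by (simp add: r_def s_def)
qed

lemma free_group_simps [simp]:
  "w \<in> carrier free_group \<longleftrightarrow> reduced_word w"
  "u \<otimes>\<^bsub>free_group\<^esub> v = freely_reduce (u @ v)"
  "\<one>\<^bsub>free_group\<^esub> = []"
  by (simp_all add: free_group_def)

lemma inv_free_group: "reduced_word w \<Longrightarrow> inv\<^bsub>free_group\<^esub> w = inv_word w"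
  by (intro group.inv_equality[OF group_free_group]) simp_all

section \<open>Prefixes of boundary points\<close>

definition bd_prefix :: "nat \<Rightarrow> (nat \<Rightarrow> 'a letter) \<Rightarrow> 'a letter list" where
  "bd_prefix n \<omega> = map \<omega> [0..<n]"

lemma length_bd_prefix [simp]: "length (bd_prefix n \<omega>) = n"
  by (simp add: bd_prefix_def)

lemma nth_bd_prefix [simp]: "i < n \<Longrightarrow> bd_prefix n \<omega> ! i = \<omega> i"
  by (simp add: bd_prefix_def)

lemma bd_prefix_0 [simp]: "bd_prefix 0 \<omega> = []"
  by (simp add: bd_prefix_def)

lemma bd_prefix_eq_Nil [simp]: "bd_prefix n \<omega> = [] \<longleftrightarrow> n = 0"
  by (simp add: bd_prefix_def)

lemma bd_prefix_Suc: "bd_prefix (Suc n) \<omega> = bd_prefix n \<omega> @ [\<omega> n]"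
  by (simp add: bd_prefix_def)

lemma last_bd_prefix: "last (bd_prefix (Suc n) \<omega>) = \<omega> n"
  by (simp add: bd_prefix_Suc)

lemma take_bd_prefix [simp]: "k \<le> n \<Longrightarrow> take k (bd_prefix n \<omega>) = bd_prefix k \<omega>"
  by (simp add: bd_prefix_def take_map)

lemma bd_prefix_append:
  assumes "n \<le> m" shows "bd_prefix m \<omega> = bd_prefix n \<omega> @ map \<omega> [n..<m]"
  using upt_add_eq_append[of 0 n "m - n"] assms by (simp add: bd_prefix_def)

lemma bd_prefix_eq_iff: "bd_prefix n \<omega> = w \<longleftrightarrow> length w = n \<and> (\<forall>i<n. \<omega> i = w ! i)"
  by (auto simp: list_eq_iff_nth_eq)

lemma reduced_bd_prefix: "\<omega> \<in> boundary \<Longrightarrow> reduced_word (bd_prefix n \<omega>)"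
proof (induction n)
  case (Suc n)
  show ?case
    unfolding bd_prefix_Suc reduced_word_append
    using Suc by (cases n) (auto simp: boundary_def last_bd_prefix)
qed simp

lemma cylinder_eq: "cylinder w = {\<omega> \<in> boundary. bd_prefix (length w) \<omega> = w}"
  by (auto simp: cylinder_def bd_prefix_eq_iff)

text \<open>The Busemann function is the distance from \<open>h\<close> to the \<open>n\<close>-th
  point of the ray, minus \<open>n\<close>, once \<open>n\<close> is at least the length of
  \<open>h\<close>. The Gromov product is the length of the cancelling prefix.\<close>

lemma length_freely_reduce_busemann:
  assumes "\<omega> \<in> boundary" "reduced_word h" "length h \<le> n"
  shows "int (length (freely_reduce (inv_word h @ bd_prefix n \<omega>))) = busemann \<omega> h + int n"
proof -
  let ?S = "{n. n \<le> length h \<and> (\<forall>i<n. h ! i = \<omega> i)}"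
  define c where "c = gromov_product h \<omega>"
  have "finite ?S" by (rule finite_subset[of _ "{..length h}"]) auto
  moreover have "0 \<in> ?S" by simp
  ultimately have c: "c \<in> ?S" and max: "\<And>k. k \<in> ?S \<Longrightarrow> k \<le> c"
    unfolding c_def gromov_product_def using Max_in[of ?S] Max_ge[of ?S] by blast+
  have "take c h = take c (bd_prefix n \<omega>)" using c assms(3) by (auto simp: list_eq_iff_nth_eq)
  moreover have "c = length h \<or> h ! c \<noteq> \<omega> c"
    using max[of "Suc c"] c by (auto simp: less_Suc_eq)
  then have "c = length h \<or> c = n \<or> h ! c \<noteq> bd_prefix n \<omega> ! c"
    using c assms(3) by (cases "c < n") auto
  ultimately have "length (freely_reduce (inv_word h @ bd_prefix n \<omega>)) + 2 * c = length h + n"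
    using length_freely_reduce_cancel[of h "bd_prefix n \<omega>" c] assms c reduced_bd_prefix[OF assms(1)]
    by auto
  then show ?thesis by (simp add: busemann_def c_def)
qed

lemma busemann_bd_prefix:
  assumes "\<omega> \<in> boundary" shows "busemann \<omega> (bd_prefix n \<omega>) = - int n"
  using length_freely_reduce_busemann[OF assms reduced_bd_prefix[OF assms], of n n] by simp

section \<open>Walks in the Schreier graph\<close>

definition step :: "'a coset \<Rightarrow> 'a letter \<Rightarrow> 'a coset" where
  "step x a = x #>\<^bsub>free_group\<^esub> [a]"

definition walk :: "'a coset \<Rightarrow> 'a letter list \<Rightarrow> 'a coset" where
  "walk = foldl step"

primrec edges :: "'a coset \<Rightarrow> 'a letter list \<Rightarrow> 'a edge list" where
  "edges x [] = []"
| "edges x (a # w) = (x, a) # edges (step x a) w"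

lemma walk_simps [simp]:
  "walk x [] = x" "walk x (a # w) = walk (step x a) w" "walk x (u @ v) = walk (walk x u) v"
  by (simp_all add: walk_def)

lemma edges_append [simp]: "edges x (u @ v) = edges x u @ edges (walk x u) v"
  by (induction u arbitrary: x) simp_all

lemma length_edges [simp]: "length (edges x w) = length w"
  by (induction w arbitrary: x) simp_all

lemma edges_eq_Nil [simp]: "edges x w = [] \<longleftrightarrow> w = []"
  by (metis length_edges length_0_conv)

lemma map_snd_edges [simp]: "map snd (edges x w) = w"
  by (induction w arbitrary: x) simp_all

lemma reverse_edge_eq: "reverse_edge (x, a) = (step x a, inv_letter a)"
  by (simp add: reverse_edge_def step_def)

text \<open>Successive edges of a walk share a vertex, so backtracking can be read off the labels
  alone.\<close>

lemma successively_edges_iff: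
  "successively (\<lambda>e f. f \<noteq> reverse_edge e) (edges x w) \<longleftrightarrow> reduced_word w"
proof (induction w arbitrary: x)
  case (Cons a w)
  then show ?case by (cases w) (auto simp: reduced_word_def reverse_edge_eq)
qed simp

section \<open>Walks of the graph library as words\<close>

lemma edge_subgraph_simps [simp]:
  "verts (edge_subgraph H S) = rcosets\<^bsub>free_group\<^esub> H" "arcs (edge_subgraph H S) = S"
  "tail (edge_subgraph H S) = fst" "head (edge_subgraph H S) (x, a) = step x a"
  by (simp_all add: edge_subgraph_def schreier_graph_def step_def)

lemma schreier_graph_simps [simp]:
  "verts (schreier_graph H) = rcosets\<^bsub>free_group\<^esub> H"
  "arcs (schreier_graph H) = (rcosets\<^bsub>free_group\<^esub> H) \<times> UNIV"
  "tail (schreier_graph H) = fst" "head (schreier_graph H) (x, a) = step x a"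
  by (simp_all add: schreier_graph_def step_def)

lemma schreier_graph_eq_edge_subgraph:
  "schreier_graph H = edge_subgraph H ((rcosets\<^bsub>free_group\<^esub> H) \<times> UNIV)"
  by (simp add: edge_subgraph_def schreier_graph_def)

text \<open>A walk is determined by its initial vertex and its labels, so every path argument can be
  carried out on words.\<close>

lemma cas_iff:
  "pre_digraph.cas (edge_subgraph H S) u p v \<longleftrightarrow> (\<exists>w. p = edges u w \<and> walk u w = v)"
proof (induction p arbitrary: u)
  case Nil
  show ?case by (auto simp: pre_digraph.cas.simps eq_commute[of "[]"])
next
  case (Cons e p)
  obtain x a where e: "e = (x, a)" by (rule prod.exhaust)
  show ?case
  proof
    assume "pre_digraph.cas (edge_subgraph H S) u (e # p) v"
    then obtain w where "x = u" "p = edges (step u a) w" "walk (step u a) w = v"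
      using Cons by (auto simp: pre_digraph.cas.simps e)
    then show "\<exists>w. e # p = edges u w \<and> walk u w = v"
      by (intro exI[of _ "a # w"]) (simp add: e)
  next
    assume "\<exists>w. e # p = edges u w \<and> walk u w = v"
    then obtain w where w: "e # p = edges u w" "walk u w = v" by blast
    then obtain w' where "w = a # w'" by (cases w) (auto simp: e)
    then show "pre_digraph.cas (edge_subgraph H S) u (e # p) v"
      using w Cons by (auto simp: pre_digraph.cas.simps e)
  qed
qed

lemma awalk_iff:
  "pre_digraph.awalk (edge_subgraph H S) u p v \<longleftrightarrow>
     u \<in> rcosets\<^bsub>free_group\<^esub> H \<and> (\<exists>w. p = edges u w \<and> set (edges u w) \<subseteq> S \<and> walk u w = v)"
  by (auto simp: pre_digraph.awalk_def cas_iff)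

lemma nth_awalk_verts:
  assumes "i \<le> length w"
  shows "pre_digraph.awalk_verts (edge_subgraph H S) u (edges u w) ! i = walk u (take i w)"
  using assms
proof (induction w arbitrary: u i)
  case (Cons a w)
  then show ?case by (cases i) (simp_all add: pre_digraph.awalk_verts.simps)
qed (simp add: pre_digraph.awalk_verts.simps)

lemma length_awalk_verts_edges:
  "length (pre_digraph.awalk_verts (edge_subgraph H S) u (edges u w)) = Suc (length w)"
  by (simp add: pre_digraph.length_awalk_verts)

lemma closed_subwalk:
  assumes "\<not> distinct (pre_digraph.awalk_verts (edge_subgraph H S) x (edges x w))"
  obtains i j where "i < j" "j \<le> length w" "walk x (take i w) = walk x (take j w)"
proof -
  let ?vs = "pre_digraph.awalk_verts (edge_subgraph H S) x (edges x w)"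
  obtain i j where "i < j" "j < length ?vs" "?vs ! i = ?vs ! j"
    using assms unfolding distinct_conv_nth by (metis linorder_neqE_nat)
  then show thesis using that[of i j] by (simp add: length_awalk_verts_edges nth_awalk_verts)
qed

lemma drop_take_subwalk:
  assumes "i \<le> j" "j \<le> length w"
  shows "walk x (take j w) = walk (walk x (take i w)) (drop i (take j w))"
    and "set (edges (walk x (take i w)) (drop i (take j w))) \<subseteq> set (edges x w)"
    and "reduced_word w \<Longrightarrow> reduced_word (drop i (take j w))"
proof -
  have j: "take j w = take i w @ drop i (take j w)"
    using assms by (metis append_take_drop_id min.absorb1 take_take)
  have w: "w = take i w @ drop i (take j w) @ drop j w"
    by (metis append.assoc append_take_drop_id j)
  show "walk x (take j w) = walk (walk x (take i w)) (drop i (take j w))"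
    by (subst j) simp
  show "set (edges (walk x (take i w)) (drop i (take j w))) \<subseteq> set (edges x w)"
    using arg_cong[OF w, of "\<lambda>w. set (edges x w)"] by auto
  show "reduced_word w \<Longrightarrow> reduced_word (drop i (take j w))"
    using arg_cong[OF w, of reduced_word] by (simp add: reduced_word_append)
qed

lemma nth_edges: "i < length w \<Longrightarrow> edges x w ! i = (walk x (take i w), w ! i)"
proof (induction w arbitrary: x i)
  case (Cons a w)
  then show ?case by (cases i) simp_all
qed simp

lemma graph_dist_eq:
  assumes "x \<in> rcosets\<^bsub>free_group\<^esub> H"
  shows "graph_dist (edge_subgraph H S) x y =
    (LEAST n. \<exists>w. set (edges x w) \<subseteq> S \<and> walk x w = y \<and> length w = n)"
proof -
  have "(\<exists>p. pre_digraph.awalk (edge_subgraph H S) x p y \<and> length p = n) \<longleftrightarrow>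
      (\<exists>w. set (edges x w) \<subseteq> S \<and> walk x w = y \<and> length w = n)" for n
    unfolding awalk_iff using assms length_edges by metis
  then show ?thesis unfolding graph_dist_def by presburger
qed

section \<open>Walks on the cosets of a subgroup\<close>

locale schreier =
  fixes H :: "'a letter list set"
  assumes subgroup_H: "subgroup H free_group"
begin

abbreviation V :: "'a coset set" where
  "V \<equiv> rcosets\<^bsub>free_group\<^esub> H"

lemma H_reduced: "h \<in> H \<Longrightarrow> reduced_word h"
  using subgroup.subset[OF subgroup_H] free_group_simps(1) by blast

lemma H_in_V: "H \<in> V"
  using subgroup.subgroup_in_rcosets[OF subgroup_H group_free_group] .

lemma H_subset: "H \<subseteq> carrier free_group"
  using subgroup.subset[OF subgroup_H] .

lemma V_cases:
  assumes "x \<in> V"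
  obtains g where "reduced_word g" "x = H #>\<^bsub>free_group\<^esub> g"
  using assms by (auto simp: RCOSETS_def)

lemma V_subset: "x \<in> V \<Longrightarrow> x \<subseteq> carrier free_group"
  by (rule subgroup.rcosets_carrier[OF subgroup_H group_free_group])

lemma step_coset:
  "reduced_word g \<Longrightarrow> step (H #>\<^bsub>free_group\<^esub> g) a = H #>\<^bsub>free_group\<^esub> (freely_reduce (g @ [a]))"
  unfolding step_def by (subst group.coset_mult_assoc[OF group_free_group H_subset]) simp_all

lemma step_in_V: assumes "x \<in> V" shows "step x a \<in> V"
proof -
  obtain g where "reduced_word g" "x = H #>\<^bsub>free_group\<^esub> g" using V_cases[OF assms] .
  then show ?thesis by (auto simp: step_coset RCOSETS_def reduced_word_freely_reduce)
qed

lemma step_inv: assumes "x \<in> V" shows "step (step x a) (inv_letter a) = x"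
proof -
  have "freely_reduce ([a] @ [inv_letter a]) = []"
    by (simp add: freely_reduce_Cons push_letter_def)
  then show ?thesis
    unfolding step_def using V_subset[OF assms] group.coset_mult_one[OF group_free_group, of x]
    by (subst group.coset_mult_assoc[OF group_free_group]) simp_all
qed

lemma walk_in_V: "x \<in> V \<Longrightarrow> walk x w \<in> V"
  by (induction w arbitrary: x) (simp_all add: step_in_V)

lemma walk_push_letter: "x \<in> V \<Longrightarrow> walk x (push_letter a w) = walk (step x a) w"
  by (auto simp: push_letter_def step_inv split: list.split)

lemma walk_freely_reduce: "x \<in> V \<Longrightarrow> walk x (freely_reduce w) = walk x w"
  by (induction w arbitrary: x) (simp_all add: freely_reduce_Cons walk_push_letter step_in_V)

lemma walk_inv_word: "x \<in> V \<Longrightarrow> walk (walk x w) (inv_word w) = x"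
  by (induction w arbitrary: x) (simp_all add: step_in_V step_inv)

lemma walk_H_eq: "walk H w = H #>\<^bsub>free_group\<^esub> (freely_reduce w)"
proof (induction w rule: rev_induct)
  case Nil
  show ?case using group.coset_mult_one[OF group_free_group H_subset] by simp
next
  case (snoc a w)
  then show ?case
    by (simp add: step_coset reduced_word_freely_reduce freely_reduce_left)
qed

text \<open>\<open>H\<close> is the stabilizer of the base coset under right multiplication.\<close>

lemma walk_H_eq_H_iff: "walk H w = H \<longleftrightarrow> freely_reduce w \<in> H"
  unfolding walk_H_eq
  using group.coset_join1[OF group_free_group _ _ subgroup_H, of "freely_reduce w"]
    group.coset_join2[OF group_free_group _ subgroup_H, of "freely_reduce w"]
  by (auto simp: reduced_word_freely_reduce)

text \<open>Elements of \<open>H\<close> label closed walks at the origin, so left translation by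
  them does not change the vertex that is reached.\<close>

lemma walk_H_inv_word:
  assumes "h \<in> H" shows "walk H (inv_word h @ w) = walk H w"
proof -
  have "walk H h = H" using assms by (simp add: walk_H_eq_H_iff freely_reduce_reduced H_reduced)
  then show ?thesis using walk_inv_word[OF H_in_V, of h] by simp
qed

end

section \<open>Geodesic spanning trees\<close>

locale schreier_tree = schreier H for H :: "'a letter list set" +
  fixes T :: "'a edge set"
  assumes geodesic_T: "geodesic_spanning_tree H T"
begin

abbreviation tree_walk :: "'a coset \<Rightarrow> 'a letter list \<Rightarrow> bool" where
  "tree_walk x w \<equiv> set (edges x w) \<subseteq> T"

lemma T_in_V: "(x, a) \<in> T \<Longrightarrow> x \<in> V"
  using geodesic_T by (auto simp: geodesic_spanning_tree_def spanning_tree_def)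

lemma T_reverse_iff:
  assumes "x \<in> V" shows "(step x a, inv_letter a) \<in> T \<longleftrightarrow> (x, a) \<in> T"
proof -
  have "(x, a) \<in> T \<Longrightarrow> (step x a, inv_letter a) \<in> T" for x a
  proof -
    assume "(x, a) \<in> T"
    moreover have "reverse_edge ` T \<subseteq> T"
      using geodesic_T by (simp add: geodesic_spanning_tree_def spanning_tree_def)
    ultimately have "reverse_edge (x, a) \<in> T" by blast
    then show "(step x a, inv_letter a) \<in> T" by (simp only: reverse_edge_eq)
  qed
  from this[of x a] this[of "step x a" "inv_letter a"] show ?thesis
    using step_inv[OF assms, of a] by auto
qed

lemma tree_walk_inv_word:
  assumes "x \<in> V" "tree_walk x w" shows "tree_walk (walk x w) (inv_word w)"
  using assms
proof (induction w arbitrary: x)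
  case (Cons a w)
  then show ?case
    using T_reverse_iff[of x a] walk_inv_word[of "step x a" w] by (auto simp: step_in_V)
qed simp

lemma tree_walk_push_letter:
  assumes "(x, a) \<in> T" "tree_walk (step x a) w" shows "tree_walk x (push_letter a w)"
  using assms step_inv[OF T_in_V, of x a a] by (auto simp: push_letter_def split: list.splits)

lemma tree_walk_freely_reduce:
  "tree_walk x w \<Longrightarrow> tree_walk x (freely_reduce w)"
  by (induction w arbitrary: x) (simp_all add: freely_reduce_Cons tree_walk_push_letter)

text \<open>Induction on the length: a closed reduced walk is either a circuit, which the tree
  excludes, or a repeated vertex cuts out a shorter closed walk, which is again reduced.\<close>

lemma no_reduced_closed_tree_walk:
  assumes "x \<in> V" "reduced_word w" "tree_walk x w" "walk x w = x"
  shows "w = []"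
  using assms
proof (induction "length w" arbitrary: x w rule: less_induct)
  case less
  let ?vs = "pre_digraph.awalk_verts (edge_subgraph H T) x (edges x w)"
  show ?case
  proof (rule ccontr)
    assume w: "w \<noteq> []"
    show False
    proof (cases "distinct (tl ?vs)")
      case True
      have "pre_digraph.awalk (edge_subgraph H T) x (edges x w) x"
        using less.prems by (auto simp: awalk_iff)
      then have "pre_digraph.cycle (edge_subgraph H T) (edges x w)"
        using True w by (auto simp: pre_digraph.cycle_def)
      moreover have "successively (\<lambda>e f. f \<noteq> reverse_edge e) (edges x w)"
        using less.prems by (simp add: successively_edges_iff)
      ultimately show False
        using geodesic_T by (auto simp: geodesic_spanning_tree_def spanning_tree_def)
    next
      case False
      \<comment> \<open>The repetition is sought after the initial vertex, so the closed subwalk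
        omits the first edge and is shorter.\<close>
      then obtain i j where ij: "i < j" "j < length (tl ?vs)" "tl ?vs ! i = tl ?vs ! j"
        unfolding distinct_conv_nth by (metis linorder_neqE_nat)
      then have ij': "Suc i < Suc j" "Suc j \<le> length w"
          "walk x (take (Suc i) w) = walk x (take (Suc j) w)"
        by (simp_all add: length_awalk_verts_edges nth_tl nth_awalk_verts)
      let ?y = "walk x (take (Suc i) w)" and ?v = "drop (Suc i) (take (Suc j) w)"
      have "length ?v < length w" using ij' by simp
      moreover have "walk ?y ?v = ?y"
        using drop_take_subwalk(1)[of "Suc i" "Suc j" w x] ij' by simp
      moreover have "tree_walk ?y ?v"
        using drop_take_subwalk(2)[of "Suc i" "Suc j" w x] ij' less.prems by auto
      moreover have "reduced_word ?v"
        using drop_take_subwalk(3)[of "Suc i" "Suc j" w] ij' less.prems by auto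
      ultimately have "?v = []"
        using less.hyps[of ?v ?y] less.prems(1) by (simp add: walk_in_V)
      then show False using ij' by simp
    qed
  qed
qed

text \<open>Going back along \<open>w\<close> and then along \<open>w'\<close> is a closed tree
  walk, whose free reduction must be empty.\<close>

lemma tree_walk_unique:
  assumes "x \<in> V" "tree_walk x w" "tree_walk x w'" "walk x w = walk x w'"
  shows "freely_reduce w = freely_reduce w'"
proof -
  let ?y = "walk x w"
  have back_x: "walk ?y (inv_word w) = x" using assms(1) by (rule walk_inv_word)
  have "tree_walk ?y (inv_word w @ w')"
    using tree_walk_inv_word[OF assms(1,2)] assms(3) back_x by simp
  then have "tree_walk ?y (freely_reduce (inv_word w @ w'))" by (rule tree_walk_freely_reduce)
  moreover have "walk ?y (inv_word w @ w') = ?y" using assms(4) back_x by simp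
  ultimately have "freely_reduce (inv_word w @ w') = []"
    using assms(1) by (intro no_reduced_closed_tree_walk[of ?y])
      (simp_all add: walk_in_V reduced_word_freely_reduce walk_freely_reduce del: walk_simps(3))
  then show ?thesis by (simp add: freely_reduce_eq_iff_inv)
qed

lemma tree_walk_exists:
  assumes "x \<in> V" "y \<in> V" obtains w where "tree_walk x w" "walk x w = y"
proof -
  obtain p where "pre_digraph.awalk (edge_subgraph H T) x p y"
    using geodesic_T assms unfolding geodesic_spanning_tree_def spanning_tree_def
      schreier_graph_simps(1) by blast
  then show thesis using that by (auto simp: awalk_iff)
qed

text \<open>These words form the Schreier transversal of \<open>H\<close> that belongs to
  \<open>T\<close>.\<close>

definition tree_word :: "'a coset \<Rightarrow> 'a letter list" where
  "tree_word x = (THE w. reduced_word w \<and> tree_walk H w \<and> walk H w = x)"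

lemma tree_word_eqI:
  assumes "reduced_word w" "tree_walk H w" "walk H w = x"
  shows "tree_word x = w"
  unfolding tree_word_def
proof (rule the_equality)
  fix w' assume "reduced_word w' \<and> tree_walk H w' \<and> walk H w' = x"
  then show "w' = w" using tree_walk_unique[of H w' w] assms H_in_V by (simp add: freely_reduce_reduced)
qed (use assms in simp)

lemma tree_word:
  assumes "x \<in> V"
  shows "reduced_word (tree_word x)" "tree_walk H (tree_word x)" "walk H (tree_word x) = x"
proof -
  obtain w where w: "tree_walk H w" "walk H w = x" using tree_walk_exists[OF H_in_V assms] .
  then have "tree_word x = freely_reduce w"
    by (intro tree_word_eqI)
      (simp_all add: reduced_word_freely_reduce tree_walk_freely_reduce walk_freely_reduce H_in_V)
  with w show "reduced_word (tree_word x)" "tree_walk H (tree_word x)" "walk H (tree_word x) = x"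
    by (simp_all add: reduced_word_freely_reduce tree_walk_freely_reduce walk_freely_reduce H_in_V)
qed

lemma tree_word_H [simp]: "tree_word H = []"
  by (rule tree_word_eqI) simp_all

lemma tree_word_walk:
  assumes "x \<in> V" "tree_walk x w"
  shows "tree_word (walk x w) = freely_reduce (tree_word x @ w)"
  using assms tree_word[of x] tree_walk_freely_reduce[of H "tree_word x @ w"]
  by (intro tree_word_eqI) (simp_all add: reduced_word_freely_reduce walk_freely_reduce H_in_V)

section \<open>Tree paths and Schreier generators\<close>

lemma reduced_if_distinct_verts:
  assumes "x \<in> V" "distinct (pre_digraph.awalk_verts (edge_subgraph H S) x (edges x w))"
  shows "reduced_word w"
  using assms
proof (induction w arbitrary: x)
  case (Cons a w)
  have "reduced_word w"
    using Cons.IH[of "step x a"] Cons.prems by (simp add: step_in_V pre_digraph.awalk_verts.simps)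
  moreover have "hd w \<noteq> inv_letter a" if "w \<noteq> []"
  proof
    let ?vs = "pre_digraph.awalk_verts (edge_subgraph H S) (step x a) (edges (step x a) w)"
    assume "hd w = inv_letter a"
    then have "walk (step x a) (take 1 w) = x"
      using that step_inv[OF Cons.prems(1), of a] by (cases w) simp_all
    then have "?vs ! 1 = x"
      using that nth_awalk_verts[of 1 w H S "step x a"] by (cases w) simp_all
    then have "x \<in> set ?vs"
      using that nth_mem[of 1 ?vs] by (simp add: length_awalk_verts_edges)
    then show False using Cons.prems(2) by (simp add: pre_digraph.awalk_verts.simps)
  qed
  ultimately show ?case using reduced_word_append[of "[a]" w] by auto
qed simp

text \<open>A repeated vertex would cut out a nonempty reduced closed tree walk. So the paths used
  to define the generators are the reduced tree walks.\<close>

lemma distinct_verts_if_reduced: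
  assumes "x \<in> V" "reduced_word w" "tree_walk x w"
  shows "distinct (pre_digraph.awalk_verts (edge_subgraph H S) x (edges x w))"
proof (rule ccontr)
  assume "\<not> ?thesis"
  then obtain i j where ij: "i < j" "j \<le> length w" "walk x (take i w) = walk x (take j w)"
    by (rule closed_subwalk)
  have "drop i (take j w) = []"
    using drop_take_subwalk(1,2)[of i j w x] drop_take_subwalk(3)[of i j w] ij assms
    by (intro no_reduced_closed_tree_walk[of "walk x (take i w)"]) (auto simp: walk_in_V)
  then show False using ij by simp
qed

lemma tree_path_eq:
  assumes "x \<in> V" "reduced_word w" "tree_walk x w" "walk x w = y"
  shows "tree_path H T x y = edges x w"
  unfolding tree_path_def
proof (rule the_equality)
  show "pre_digraph.apath (edge_subgraph H T) x (edges x w) y"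
    using assms distinct_verts_if_reduced[of x w] by (auto simp: pre_digraph.apath_def awalk_iff)
next
  fix p assume "pre_digraph.apath (edge_subgraph H T) x p y"
  then obtain w' where w': "p = edges x w'" "tree_walk x w'" "walk x w' = y" "reduced_word w'"
    using reduced_if_distinct_verts[OF assms(1)] by (auto simp: pre_digraph.apath_def awalk_iff)
  then have "w' = w" using tree_walk_unique[of x w' w] assms by (simp add: freely_reduce_reduced)
  then show "p = edges x w" using w' by simp
qed

lemma schreier_generator_eq:
  assumes "x \<in> V"
  shows "schreier_generator H T (x, a) =
    freely_reduce (tree_word x @ [a] @ inv_word (tree_word (step x a)))"
proof -
  have y: "step x a \<in> V" using assms by (rule step_in_V)
  have "tree_path H T H x = edges H (tree_word x)"
    using tree_word[OF assms] by (intro tree_path_eq H_in_V)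
  moreover have "tree_path H T (step x a) H = edges (step x a) (inv_word (tree_word (step x a)))"
    using tree_word[OF y] tree_walk_inv_word[OF H_in_V tree_word(2)[OF y]]
      walk_inv_word[OF H_in_V, of "tree_word (step x a)"]
    by (intro tree_path_eq y) simp_all
  ultimately show ?thesis by (simp add: schreier_generator_def)
qed

section \<open>Distances from the origin\<close>

definition height :: "'a coset \<Rightarrow> nat" where
  "height x = graph_dist (schreier_graph H) H x"

lemma height_walk_le: "height (walk H w) \<le> length w"
proof -
  have "set (edges x w) \<subseteq> V \<times> UNIV" if "x \<in> V" for x
    using that by (induction w arbitrary: x) (simp_all add: step_in_V)
  then show ?thesis
    unfolding height_def schreier_graph_eq_edge_subgraph graph_dist_eq[OF H_in_V]
    using H_in_V by (intro Least_le) blast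
qed

text \<open>This is where the geodesic property of \<open>T\<close> enters. A shortest tree walk
  reduces to the tree word, whose length is therefore the distance in the tree and hence in the
  graph.\<close>

lemma length_tree_word:
  assumes "x \<in> V" shows "length (tree_word x) = height x"
proof (rule antisym)
  have "height x = (LEAST n. \<exists>w. tree_walk H w \<and> walk H w = x \<and> length w = n)"
    using geodesic_T assms unfolding height_def geodesic_spanning_tree_def
    by (simp add: graph_dist_eq[OF H_in_V])
  moreover have "\<exists>n w. tree_walk H w \<and> walk H w = x \<and> length w = n"
    using tree_word[OF assms] by blast
  ultimately have "\<exists>w. tree_walk H w \<and> walk H w = x \<and> length w = height x"
    using LeastI_ex[of "\<lambda>n. \<exists>w. tree_walk H w \<and> walk H w = x \<and> length w = n"] by presburger
  then obtain w where w: "tree_walk H w" "walk H w = x" "length w = height x"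
    by blast
  then have "tree_word x = freely_reduce w"
    using tree_word_walk[OF H_in_V w(1)] by simp
  then show "length (tree_word x) \<le> height x"
    using length_freely_reduce_le[of w] w by simp
  show "height x \<le> length (tree_word x)"
    using height_walk_le[of "tree_word x"] tree_word[OF assms] by simp
qed

lemma height_step_le: assumes "x \<in> V" shows "height (step x a) \<le> Suc (height x)"
  using height_walk_le[of "tree_word x @ [a]"] tree_word[OF assms] length_tree_word[OF assms] by simp

text \<open>Any cancellation with the tree word of \<open>x\<close> would leave too few letters for
  the height of the end vertex.\<close>

lemma tree_word_walk_height:
  assumes "x \<in> V" "tree_walk x w" "height (walk x w) = height x + length w"
  shows "tree_word (walk x w) = tree_word x @ w"
proof -
  have *: "tree_word (walk x w) = freely_reduce (tree_word x @ w)"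
    using tree_word_walk[OF assms(1,2)] .
  have "length (tree_word (walk x w)) = length (tree_word x @ w)"
    using assms length_tree_word walk_in_V by simp
  then show ?thesis
    using * freely_reduce_eq_if_length[of "tree_word x @ w"] by simp
qed

text \<open>The edge is the last one of the tree path from the origin to \<open>x\<close>,
  reversed.\<close>

lemma lower_tree_edge:
  assumes "x \<in> V" "height x > 0"
  obtains b where "(x, b) \<in> T" "height (step x b) < height x"
proof -
  have "tree_word x \<noteq> []" using assms length_tree_word by fastforce
  then obtain u a where ua: "tree_word x = u @ [a]" by (metis rev_exhaust)
  let ?y = "walk H u"
  have y: "?y \<in> V" "step ?y a = x" "(?y, a) \<in> T"
    using tree_word[OF assms(1)] by (auto simp: ua walk_in_V H_in_V)
  have "height ?y < height x"
    using height_walk_le[of u] length_tree_word[OF assms(1)] by (simp add: ua)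
  then show thesis
    using that[of "inv_letter a"] T_reverse_iff[of ?y a] step_inv[of ?y a] y by auto
qed

end

section \<open>The Schreier limit set\<close>

context schreier_tree begin

text \<open>In increasing order of time, the edges passed at these times give the generators into
  which \<omega> is rewritten.\<close>

definition crossings :: "(nat \<Rightarrow> 'a letter) \<Rightarrow> nat set" where
  "crossings \<omega> = {n. (walk H (bd_prefix n \<omega>), \<omega> n) \<notin> T}"

lemma tree_walk_hd: "tree_walk x w \<Longrightarrow> w \<noteq> [] \<Longrightarrow> (x, hd w) \<in> T"
  by (cases w) simp_all

lemma tree_walk_last: "tree_walk x w \<Longrightarrow> w \<noteq> [] \<Longrightarrow> (walk x (butlast w), last w) \<in> T"
  by (cases w rule: rev_cases) simp_all

text \<open>\<open>T\<close> is closed under reversal, so an edge of the tree and an edge outside it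
  are never reverse to each other. No cancellation occurs where a walk enters or leaves the
  tree.\<close>

lemma reduced_word_junction:
  assumes "x \<in> V" "reduced_word u" "reduced_word v"
    and "u \<noteq> [] \<Longrightarrow> v \<noteq> [] \<Longrightarrow> (walk x (butlast u), last u) \<in> T \<longleftrightarrow> (walk x u, hd v) \<notin> T"
  shows "reduced_word (u @ v)"
proof -
  have "hd v \<noteq> inv_letter (last u)" if "u \<noteq> []" "v \<noteq> []"
  proof
    assume *: "hd v = inv_letter (last u)"
    have "walk x u = step (walk x (butlast u)) (last u)"
      using that(1) by (cases u rule: rev_cases) simp_all
    then show False
      using assms(4)[OF that] T_reverse_iff[of "walk x (butlast u)" "last u"] * assms(1)
      by (simp add: walk_in_V)
  qed
  then show ?thesis using assms(2,3) by (auto simp: reduced_word_append)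
qed

lemma reduced_word_cross:
  assumes "reduced_word (u @ [a])" "(walk H u, a) \<notin> T"
    and "reduced_word v" "tree_walk (walk H (u @ [a])) v"
  shows "reduced_word (u @ [a] @ v)"
  using reduced_word_junction[OF H_in_V assms(1,3)] tree_walk_hd[OF assms(4)] assms(2) by simp

lemma tree_walk_back: "x \<in> V \<Longrightarrow> tree_walk x (inv_word (tree_word x))"
  using tree_walk_inv_word[OF H_in_V, of "tree_word x"] tree_word[of x] by simp

lemma walk_back: "x \<in> V \<Longrightarrow> walk x (inv_word (tree_word x)) = H"
  using walk_inv_word[OF H_in_V, of "tree_word x"] tree_word[of x] by simp

lemma reduced_word_back: "x \<in> V \<Longrightarrow> reduced_word (inv_word (tree_word x))"
  by (simp add: tree_word)

lemma schreier_generator_tree: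
  assumes "(x, a) \<in> T" shows "schreier_generator H T (x, a) = []"
proof -
  have x: "x \<in> V" using assms by (rule T_in_V)
  have "freely_reduce (tree_word x @ [a]) = tree_word (step x a)"
    using tree_word_walk[of x "[a]"] x assms by simp
  then show ?thesis
    using freely_reduce_left[of "tree_word x @ [a]" "inv_word (tree_word (step x a))"]
    by (simp add: schreier_generator_eq x)
qed

text \<open>The edge outside \<open>T\<close> separates two tree paths, so both junctions are free
  of cancellation.\<close>

lemma schreier_generator_non_tree:
  assumes "x \<in> V" "(x, a) \<notin> T"
  shows "reduced_word (tree_word x @ [a])"
    and "schreier_generator H T (x, a) = tree_word x @ [a] @ inv_word (tree_word (step x a))"
proof -
  show *: "reduced_word (tree_word x @ [a])"
    using assms tree_word[OF assms(1)] tree_walk_last[of H "tree_word x"]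
    by (intro reduced_word_junction[OF H_in_V]) simp_all
  have "reduced_word (tree_word x @ [a] @ inv_word (tree_word (step x a)))"
    using assms tree_word[OF assms(1)] tree_walk_back[of "step x a"]
    by (intro reduced_word_cross[OF *]) (simp_all add: step_in_V tree_word)
  then show "schreier_generator H T (x, a) = tree_word x @ [a] @ inv_word (tree_word (step x a))"
    by (simp add: schreier_generator_eq assms freely_reduce_reduced)
qed

lemma inv_word_schreier_generator:
  assumes "x \<in> V" "(x, a) \<notin> T"
  shows "inv_word (schreier_generator H T (x, a)) = schreier_generator H T (step x a, inv_letter a)"
  using assms by (simp add: schreier_generator_non_tree step_in_V T_reverse_iff step_inv)

lemma inv_schreier_generator:
  assumes "x \<in> V" "(x, a) \<notin> T"
  shows "inv\<^bsub>free_group\<^esub> (schreier_generator H T (x, a)) =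
    schreier_generator H T (step x a, inv_letter a)"
  using inv_word_schreier_generator[OF assms] schreier_generator_eq[OF assms(1)]
  by (simp add: inv_free_group reduced_word_freely_reduce)

lemma filter_edges_tree_walk: "tree_walk x w \<Longrightarrow> filter (\<lambda>e. e \<notin> T) (edges x w) = []"
  by (auto simp: filter_empty_conv)

text \<open>The edge is recovered as the only edge of the walk of its generator outside the tree.\<close>

lemma schreier_generator_inj:
  assumes "x \<in> V" "(x, a) \<notin> T" "y \<in> V" "(y, b) \<notin> T"
    and "schreier_generator H T (x, a) = schreier_generator H T (y, b)"
  shows "(x, a) = (y, b)"
proof -
  have *: "filter (\<lambda>e. e \<notin> T) (edges H (schreier_generator H T (x, a))) = [(x, a)]"
    if "x \<in> V" "(x, a) \<notin> T" for x a
  proof -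
    let ?u = "tree_word x" and ?v = "inv_word (tree_word (step x a))"
    have "edges H (schreier_generator H T (x, a)) = edges H ?u @ [(x, a)] @ edges (step x a) ?v"
      by (simp only: schreier_generator_non_tree(2)[OF that] edges_append edges.simps walk_simps
          tree_word(3)[OF that(1)])
    then show ?thesis
      using filter_edges_tree_walk[OF tree_word(2)[OF that(1)]] that(2)
        filter_edges_tree_walk[OF tree_walk_back[OF step_in_V[OF that(1), of a]]]
      by (simp only: filter_append) simp
  qed
  have "[(x, a)] = [(y, b)]"
    using *[OF assms(1,2)] *[OF assms(3,4)] unfolding assms(5) by (rule trans[OF sym])
  then show ?thesis by simp
qed

text \<open>Reidemeister--Schreier rewriting: this is the product of the generators of the edges passed
  by \<open>w\<close>, where tree edges contribute the identity.\<close>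

definition rewritten :: "'a letter list \<Rightarrow> 'a letter list" where
  "rewritten w = freely_reduce (w @ inv_word (tree_word (walk H w)))"

text \<open>The return path that ends \<open>rewritten w\<close> cancels against the outgoing tree
  path of the next generator, so the product telescopes.\<close>

lemma rewritten_snoc:
  "rewritten (w @ [a]) = freely_reduce (rewritten w @ schreier_generator H T (walk H w, a))"
proof -
  let ?x = "walk H w"
  let ?t = "tree_word ?x" and ?t' = "tree_word (step ?x a)"
  have "freely_reduce (rewritten w @ schreier_generator H T (?x, a)) =
      freely_reduce ((w @ inv_word ?t) @ (?t @ [a] @ inv_word ?t'))"
    by (intro freely_reduce_cong) (simp_all add: rewritten_def schreier_generator_eq walk_in_V H_in_V
        freely_reduce_reduced reduced_word_freely_reduce)
  also have "\<dots> = freely_reduce (w @ (inv_word ?t @ ?t @ [a] @ inv_word ?t'))"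
    by (simp only: append_assoc)
  also have "\<dots> = freely_reduce (w @ ([a] @ inv_word ?t'))"
    by (intro freely_reduce_cong refl freely_reduce_cancel_inv)
  finally show ?thesis by (simp add: rewritten_def)
qed

lemma freely_reduce_rewritten: "freely_reduce (rewritten w) = rewritten w"
  by (simp add: rewritten_def freely_reduce_reduced reduced_word_freely_reduce)

lemma rewritten_bd_prefix_eq:
  assumes "n \<le> m" "\<And>i. n \<le> i \<Longrightarrow> i < m \<Longrightarrow> i \<notin> crossings \<omega>"
  shows "rewritten (bd_prefix m \<omega>) = rewritten (bd_prefix n \<omega>)"
  using assms
proof (induction m rule: dec_induct)
  case (step k)
  then have "(walk H (bd_prefix k \<omega>), \<omega> k) \<in> T" by (auto simp: crossings_def)
  then show ?case using step
    by (simp add: bd_prefix_Suc rewritten_snoc schreier_generator_tree freely_reduce_rewritten)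
qed simp

lemma tree_walk_segment:
  assumes "n \<le> m" "\<And>i. n \<le> i \<Longrightarrow> i < m \<Longrightarrow> i \<notin> crossings \<omega>"
  shows "tree_walk (walk H (bd_prefix n \<omega>)) (map \<omega> [n..<m])"
    and "walk (walk H (bd_prefix n \<omega>)) (map \<omega> [n..<m]) = walk H (bd_prefix m \<omega>)"
proof -
  have eq: "walk (walk H (bd_prefix n \<omega>)) (map \<omega> [n..<k]) = walk H (bd_prefix k \<omega>)" if "n \<le> k" for k
  proof -
    have "bd_prefix k \<omega> = bd_prefix n \<omega> @ map \<omega> [n..<k]"
      using that by (rule bd_prefix_append)
    then show ?thesis by simp
  qed
  then show "walk (walk H (bd_prefix n \<omega>)) (map \<omega> [n..<m]) = walk H (bd_prefix m \<omega>)"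
    using assms(1) .
  show "tree_walk (walk H (bd_prefix n \<omega>)) (map \<omega> [n..<m])"
    using assms
  proof (induction m rule: dec_induct)
    case (step k)
    then have "(walk H (bd_prefix k \<omega>), \<omega> k) \<in> T" by (auto simp: crossings_def)
    then show ?case using step eq[of k] by simp
  qed simp
qed

lemma reduced_segment:
  assumes "\<omega> \<in> boundary" "n \<le> m" shows "reduced_word (map \<omega> [n..<m])"
proof -
  have "bd_prefix m \<omega> = bd_prefix n \<omega> @ map \<omega> [n..<m]"
    using assms(2) by (rule bd_prefix_append)
  then show ?thesis using reduced_bd_prefix[OF assms(1), of m] by (simp add: reduced_word_append)
qed

text \<open>The return path starts in the tree and cannot cancel the edge just crossed. The
  rewritten prefix thus retains the whole prefix of \<omega>, which yields convergence.\<close>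

lemma rewritten_after_crossing:
  assumes "\<omega> \<in> boundary" "n \<in> crossings \<omega>"
  shows "rewritten (bd_prefix (Suc n) \<omega>) =
    bd_prefix (Suc n) \<omega> @ inv_word (tree_word (walk H (bd_prefix (Suc n) \<omega>)))"
proof -
  let ?x = "walk H (bd_prefix (Suc n) \<omega>)"
  have "?x \<in> V" by (simp add: walk_in_V H_in_V)
  then have "reduced_word (bd_prefix n \<omega> @ [\<omega> n] @ inv_word (tree_word ?x))"
    using assms reduced_bd_prefix[OF assms(1), of "Suc n"] tree_walk_back[of ?x]
      reduced_word_back[of ?x]
    by (intro reduced_word_cross) (simp_all add: bd_prefix_Suc crossings_def)
  then show ?thesis unfolding rewritten_def by (simp add: bd_prefix_Suc freely_reduce_reduced)
qed

text \<open>The generators of the successively crossed edges form the required sequence; their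
  partial products are the rewritten prefixes of \<omega>.\<close>

lemma schreier_limit_setI:
  assumes \<omega>: "\<omega> \<in> boundary" and inf: "infinite (crossings \<omega>)"
  shows "\<omega> \<in> schreier_limit_set H T"
proof -
  define e where "e = enumerate (crossings \<omega>)"
  define x where "x k = walk H (bd_prefix (e k) \<omega>)" for k
  define \<xi> where "\<xi> k = schreier_generator H T (x k, \<omega> (e k))" for k
  have e_cross: "e k \<in> crossings \<omega>" for k
    unfolding e_def using inf by (rule enumerate_in_set)
  have x_V: "x k \<in> V" for k by (simp add: x_def walk_in_V H_in_V)
  have xe: "(x k, \<omega> (e k)) \<notin> T" for k using e_cross[of k] by (simp add: crossings_def x_def)
  have e_less: "e k < e (Suc k)" for k unfolding e_def using inf by (rule enumerate_step)
  have e_ge: "k \<le> e k" for k unfolding e_def using inf by (rule le_enumerate)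
  have gap: "i \<notin> crossings \<omega>" if "Suc (e k) \<le> i" "i < e (Suc k)" for i k
    using that not_less_Least[of i "\<lambda>s. s \<in> crossings \<omega> \<and> e k < s"]
    by (auto simp: e_def enumerate_Suc''[OF inf])
  have gap0: "i \<notin> crossings \<omega>" if "i < e 0" for i
    using that not_less_Least[of i "\<lambda>s. s \<in> crossings \<omega>"] by (auto simp: e_def enumerate_0)
  have step_x: "rewritten (bd_prefix (Suc (e k)) \<omega>) = rewritten (bd_prefix (e (Suc k)) \<omega>)" for k
    using rewritten_bd_prefix_eq[of "Suc (e k)" "e (Suc k)" \<omega>] gap e_less[of k] by simp
  have pp: "partial_product \<xi> k = rewritten (bd_prefix (e k) \<omega>)" for k
  proof (induction k)
    case 0
    show ?case using rewritten_bd_prefix_eq[of 0 "e 0" \<omega>] gap0 by (simp add: rewritten_def)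
  next
    case (Suc k)
    have "partial_product \<xi> (Suc k) = rewritten (bd_prefix (Suc (e k)) \<omega>)"
      by (simp add: Suc bd_prefix_Suc rewritten_snoc \<xi>_def x_def)
    then show ?case by (simp only: step_x)
  qed
  have "words_converge (partial_product \<xi>) \<omega>"
    unfolding words_converge_def eventually_sequentially
  proof (intro allI exI impI)
    fix k n :: nat assume "Suc k \<le> n"
    then obtain m where n: "n = Suc m" and m: "k \<le> m" by (cases n) auto
    \<comment> \<open>The product agrees with \<omega> up to the crossing at time
      \<open>e m\<close>, and \<open>e m\<close> is at least \<open>m\<close>.\<close>
    have "partial_product \<xi> n = bd_prefix (Suc (e m)) \<omega> @
        inv_word (tree_word (walk H (bd_prefix (Suc (e m)) \<omega>)))"
      unfolding n pp step_x[symmetric] by (rule rewritten_after_crossing[OF \<omega> e_cross])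
    then show "k < length (partial_product \<xi> n) \<and> partial_product \<xi> n ! k = \<omega> k"
      using m e_ge[of m] by (simp add: nth_append)
  qed
  \<comment> \<open>If two successive generators were inverse, the next crossed edge would be the
    reverse of the last. The tree walk in between would then be closed, hence empty, and \<omega>
    itself would backtrack.\<close>
  moreover have "\<xi> (Suc k) \<noteq> inv\<^bsub>free_group\<^esub> (\<xi> k)" for k
  proof
    let ?y = "walk H (bd_prefix (Suc (e k)) \<omega>)"
    have y: "?y = step (x k) (\<omega> (e k))" by (simp add: bd_prefix_Suc x_def)
    assume "\<xi> (Suc k) = inv\<^bsub>free_group\<^esub> (\<xi> k)"
    then have "schreier_generator H T (x (Suc k), \<omega> (e (Suc k))) =
        schreier_generator H T (?y, inv_letter (\<omega> (e k)))"
      by (simp only: \<xi>_def y inv_schreier_generator[OF x_V xe])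
    moreover have "(?y, inv_letter (\<omega> (e k))) \<notin> T"
      using xe[of k] T_reverse_iff[OF x_V] by (simp add: y)
    ultimately have eq: "x (Suc k) = ?y" "\<omega> (e (Suc k)) = inv_letter (\<omega> (e k))"
      using schreier_generator_inj[OF x_V xe, of ?y "inv_letter (\<omega> (e k))" "Suc k"]
      by (simp_all add: walk_in_V H_in_V)
    have "map \<omega> [Suc (e k)..<e (Suc k)] = []"
      using tree_walk_segment[of "Suc (e k)" "e (Suc k)" \<omega>] gap e_less[of k] eq(1)
        reduced_segment[OF \<omega>, of "Suc (e k)" "e (Suc k)"]
      by (intro no_reduced_closed_tree_walk[of ?y]) (simp_all add: walk_in_V H_in_V x_def)
    then have "e (Suc k) = Suc (e k)" using e_less[of k] by simp
    then show False using eq(2) \<omega> by (simp add: boundary_def)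
  qed
  moreover have "\<xi> k \<in> schreier_generators H T" for k
    unfolding schreier_generators_def \<xi>_def using x_V xe by (intro imageI) simp
  ultimately show ?thesis
    using \<omega> by (auto simp: schreier_limit_set_def reduced_generator_words_def)
qed

text \<open>The letter of a generator outside the tree survives in all later products. It therefore
  appears in \<omega>, at a position that is a crossing.\<close>

lemma schreier_limit_setD:
  assumes "\<omega> \<in> schreier_limit_set H T"
  shows "infinite (crossings \<omega>)"
proof -
  obtain \<xi> where \<omega>: "\<omega> \<in> boundary" and gen: "\<And>n. \<xi> n \<in> schreier_generators H T"
    and nb: "\<And>n. \<xi> (Suc n) \<noteq> inv\<^bsub>free_group\<^esub> (\<xi> n)"
    and conv: "words_converge (partial_product \<xi>) \<omega>"
    using assms by (auto simp: schreier_limit_set_def reduced_generator_words_def)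
  have "\<exists>x a. x \<in> V \<and> (x, a) \<notin> T \<and> \<xi> n = schreier_generator H T (x, a)" for n
    using gen[of n] by (auto simp: schreier_generators_def)
  then obtain x a where x_V: "\<And>n. x n \<in> V" and xa: "\<And>n. (x n, a n) \<notin> T"
    and \<xi>: "\<And>n. \<xi> n = schreier_generator H T (x n, a n)" by metis
  define y where "y n = step (x n) (a n)" for n
  have y_V: "y n \<in> V" for n by (simp add: y_def x_V step_in_V)
  have \<xi>': "\<xi> n = tree_word (x n) @ [a n] @ inv_word (tree_word (y n))" for n
    by (simp add: \<xi> schreier_generator_non_tree x_V xa y_def)
  \<comment> \<open>\<open>q\<close> is the part of the product of the first \<open>Suc n\<close>
    factors that precedes the non-tree letter of its last factor.\<close>
  define P where "P n q \<longleftrightarrow> reduced_word (q @ [a n]) \<and> walk H q = x n \<and>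
      partial_product \<xi> (Suc n) = q @ [a n] @ inv_word (tree_word (y n))" for n q
  have "\<exists>q. \<forall>n. P n (q n) \<and> (\<exists>z. q (Suc n) = q n @ [a n] @ z)"
  proof (rule dependent_nat_choice)
    have "freely_reduce (\<xi> 0) = \<xi> 0"
      by (simp add: \<xi> schreier_generator_eq x_V freely_reduce_reduced reduced_word_freely_reduce)
    then show "\<exists>q. P 0 q"
      unfolding P_def using schreier_generator_non_tree(1)[OF x_V xa, of 0] tree_word[OF x_V, of 0]
      by (intro exI[of _ "tree_word (x 0)"]) (simp add: \<xi>')
  next
    fix q n assume P: "P n q"
    \<comment> \<open>After cancellation, \<open>z\<close> labels the tree path between two
      successive edges outside the tree.\<close>
    define z where "z = freely_reduce (inv_word (tree_word (y n)) @ tree_word (x (Suc n)))"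
    have z_red: "reduced_word z" by (simp add: z_def reduced_word_freely_reduce)
    have z_tree: "tree_walk (y n) z" unfolding z_def
      using tree_walk_back[OF y_V] walk_back[OF y_V] tree_word[OF x_V]
      by (intro tree_walk_freely_reduce) simp
    have z_walk: "walk (y n) z = x (Suc n)" unfolding z_def
      using walk_back[OF y_V] tree_word[OF x_V] by (simp add: walk_freely_reduce y_V)
    let ?q = "q @ [a n] @ z"
    have q_walk: "walk H (q @ [a n]) = y n" using P by (simp add: P_def y_def)
    have q_red: "reduced_word ?q"
      using P xa[of n] z_red z_tree q_walk by (intro reduced_word_cross) (simp_all add: P_def)
    have q'_walk: "walk H ?q = x (Suc n)" using q_walk z_walk by simp
    have q'_red: "reduced_word (?q @ [a (Suc n)])"
    proof (cases "z = []")
      case False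
      then have "(walk H (butlast ?q), last ?q) \<in> T"
        using tree_walk_last[OF z_tree] q_walk by (simp add: butlast_append)
      then show ?thesis using xa[of "Suc n"] q'_walk
        by (intro reduced_word_junction[OF H_in_V q_red]) simp_all
    next
      case True
      then have xy: "x (Suc n) = y n" using z_walk by simp
      \<comment> \<open>With \<open>z\<close> empty the two non-tree letters are adjacent; that the
        sequence \<xi> is reduced keeps them from cancelling.\<close>
      have "a (Suc n) \<noteq> inv_letter (a n)"
      proof
        assume "a (Suc n) = inv_letter (a n)"
        then have "\<xi> (Suc n) = inv\<^bsub>free_group\<^esub> (\<xi> n)"
          using xy by (simp add: \<xi> y_def inv_schreier_generator x_V xa)
        then show False using nb by blast
      qed
      then show ?thesis
        using True q_red reduced_word_append[of "q @ [a n]" "[a (Suc n)]"] by simp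
    qed
    have red: "reduced_word (?q @ [a (Suc n)] @ inv_word (tree_word (y (Suc n))))"
      using q'_red q'_walk xa[of "Suc n"] tree_walk_back[OF y_V] reduced_word_back[OF y_V]
      by (intro reduced_word_cross) (simp_all add: y_def)
    have "partial_product \<xi> (Suc (Suc n)) =
        freely_reduce ((q @ [a n]) @ (inv_word (tree_word (y n)) @ tree_word (x (Suc n))) @
          [a (Suc n)] @ inv_word (tree_word (y (Suc n))))"
      using P by (simp only: partial_product.simps(2)[of \<xi> "Suc n"] P_def free_group_simps \<xi>'[of "Suc n"] append_assoc)
    also have "\<dots> = freely_reduce ((q @ [a n]) @ z @ [a (Suc n)] @ inv_word (tree_word (y (Suc n))))"
      unfolding z_def by (intro freely_reduce_cong refl) (simp add: freely_reduce_reduced reduced_word_freely_reduce)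
    also have "\<dots> = ?q @ [a (Suc n)] @ inv_word (tree_word (y (Suc n)))"
      using red by (simp add: freely_reduce_reduced)
    finally have "P (Suc n) ?q" using q'_red q'_walk by (simp add: P_def)
    then show "\<exists>q'. P (Suc n) q' \<and> (\<exists>z. q' = q @ [a n] @ z)" by blast
  qed
  then obtain q where P: "\<And>n. P n (q n)" and ext: "\<And>n. \<exists>z. q (Suc n) = q n @ [a n] @ z" by blast
  have long: "\<exists>z. q m @ [a m] = q n @ [a n] @ z" if "n \<le> m" for n m
    using that
  proof (induction m rule: dec_induct)
    case (step m)
    then show ?case using ext[of m] by (metis append.assoc)
  qed simp
  have pref: "\<exists>z. partial_product \<xi> (Suc m) = q n @ [a n] @ z" if "n \<le> m" for n m
    using long[OF that] P[of m] unfolding P_def by (metis append.assoc)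
  have \<omega>_eq: "\<omega> k = (q n @ [a n]) ! k" if "k \<le> length (q n)" for k n
  proof -
    obtain N where "\<And>m. m \<ge> N \<Longrightarrow> partial_product \<xi> m ! k = \<omega> k"
      using conv unfolding words_converge_def eventually_sequentially by metis
    then have "partial_product \<xi> (Suc (max N n)) ! k = \<omega> k" by (simp del: partial_product.simps)
    moreover obtain z where "partial_product \<xi> (Suc (max N n)) = (q n @ [a n]) @ z"
      using pref[of n "max N n"] by auto
    ultimately show ?thesis using that by (auto simp: nth_append split: if_splits)
  qed
  have cross: "length (q n) \<in> crossings \<omega>" for n
  proof -
    have "bd_prefix (length (q n)) \<omega> = q n"
      using \<omega>_eq[of _ n] by (auto simp: bd_prefix_eq_iff nth_append)
    then show ?thesis using P[of n] xa[of n] \<omega>_eq[of "length (q n)" n] by (simp add: crossings_def P_def)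
  qed
  have "strict_mono (\<lambda>n. length (q n))"
    unfolding strict_mono_Suc_iff
  proof
    fix n show "length (q n) < length (q (Suc n))" using ext[of n] by auto
  qed
  then have "infinite (range (\<lambda>n. length (q n)))"
    using strict_mono_imp_inj_on range_inj_infinite by blast
  then show ?thesis using cross by (meson finite_subset image_subsetI)
qed

lemma schreier_limit_set_eq:
  "schreier_limit_set H T = {\<omega> \<in> boundary. infinite (crossings \<omega>)}"
  using schreier_limit_setI schreier_limit_setD by (auto simp: schreier_limit_set_def)

end

section \<open>Horospheric limit sets\<close>

lemma bounded_mono_nat_eventually_const:
  fixes f :: "nat \<Rightarrow> nat"
  assumes "\<And>n. f n \<le> f (Suc n)" "\<And>n. f n \<le> C"
  obtains N where "\<And>n. n \<ge> N \<Longrightarrow> f n = f N"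
proof -
  have mono: "f m \<le> f n" if "m \<le> n" for m n using assms(1) that by (rule lift_Suc_mono_le)
  have fin: "finite (range f)" using assms(2) by (auto intro!: finite_subset[of "range f" "{..C}"])
  then obtain N where "f N = Max (range f)" using Max_in[OF fin] by (metis UNIV_not_empty image_is_empty imageE)
  then have "f n \<le> f N" for n using fin by simp
  then show thesis using mono that[of N] by (meson antisym)
qed

lemma small_horospheric_subset_big: "small_horospheric H \<subseteq> big_horospheric H"
  unfolding small_horospheric_def big_horospheric_def
  using free_group_simps(1)[of "[]"] by (auto simp del: free_group_simps(1))

text \<open>Each of the infinitely many points of \<open>H\<close> in the horoball contributes at
  least the positive constant \<open>f g\<close> to the series.\<close>

lemma big_horospheric_subset_poincare:
  fixes H :: "'a::finite letter list set"
  shows "big_horospheric H \<subseteq> poincare_divergence H"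
proof
  fix \<omega> assume "\<omega> \<in> big_horospheric H"
  then obtain g where \<omega>: "\<omega> \<in> boundary" and inf: "infinite (H \<inter> horoball \<omega> g)"
    by (auto simp: big_horospheric_def)
  define q where "q = 2 * real CARD('a) - 1"
  define f where "f h = ennreal (q powi (- busemann \<omega> h))" for h
  have "CARD('a) \<ge> 1" by (simp add: Suc_leI)
  then have q: "q \<ge> 1" by (simp add: q_def)
  have "(\<Sum>\<^sub>\<infinity>h\<in>H \<inter> horoball \<omega> g. f h) = \<infinity>"
  proof (rule infsum_superconst_infinite_ennreal[OF _ _ inf])
    show "f g > 0" using q by (simp add: f_def ennreal_less_zero_iff)
    show "f g \<le> f h" if "h \<in> H \<inter> horoball \<omega> g" for h
      unfolding f_def using that q by (intro ennreal_leI power_int_increasing) (auto simp: horoball_def)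
  qed
  moreover have "(\<Sum>\<^sub>\<infinity>h\<in>H \<inter> horoball \<omega> g. f h) \<le> (\<Sum>\<^sub>\<infinity>h\<in>H. f h)"
    by (rule infsum_mono_neutral) (auto intro: nonneg_summable_on_complete)
  ultimately show "\<omega> \<in> poincare_divergence H"
    using \<omega> by (simp add: poincare_divergence_def f_def q_def top_unique)
qed

context schreier_tree begin

section \<open>The defect and the Busemann function on the subgroup\<close>

definition defect :: "(nat \<Rightarrow> 'a letter) \<Rightarrow> nat \<Rightarrow> nat" where
  "defect \<omega> n = n - height (walk H (bd_prefix n \<omega>))"

lemma height_bd_prefix_le: "height (walk H (bd_prefix n \<omega>)) \<le> n"
  using height_walk_le[of "bd_prefix n \<omega>"] by simp

lemma height_bd_prefix: "height (walk H (bd_prefix n \<omega>)) = n - defect \<omega> n" "defect \<omega> n \<le> n"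
  using height_bd_prefix_le[of n \<omega>] by (simp_all add: defect_def)

lemma int_defect: "int (defect \<omega> n) = int n - int (height (walk H (bd_prefix n \<omega>)))"
  using height_bd_prefix_le[of n \<omega>] by (simp add: defect_def of_nat_diff)

lemma defect_mono: "defect \<omega> n \<le> defect \<omega> (Suc n)"
  using height_step_le[of "walk H (bd_prefix n \<omega>)" "\<omega> n"] height_bd_prefix_le[of n \<omega>]
  by (simp add: defect_def bd_prefix_Suc walk_in_V H_in_V)

text \<open>The translated prefix still labels a walk from the origin to the \<open>n\<close>-th
  vertex, so its length is at least the height there.\<close>

lemma busemann_ge_defect:
  assumes "\<omega> \<in> boundary" "h \<in> H" "n \<ge> length h"
  shows "busemann \<omega> h \<ge> - int (defect \<omega> n)"
proof -
  have "height (walk H (bd_prefix n \<omega>)) \<le> length (freely_reduce (inv_word h @ bd_prefix n \<omega>))"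
    using height_walk_le[of "freely_reduce (inv_word h @ bd_prefix n \<omega>)"]
    by (simp only: walk_freely_reduce H_in_V walk_H_inv_word[OF assms(2)])
  then show ?thesis
    using length_freely_reduce_busemann[OF assms(1) H_reduced assms(3)] assms(2) int_defect[of \<omega> n] by simp
qed

text \<open>The witness follows \<omega> for \<open>n\<close> steps and returns to the origin along
  the tree.\<close>

lemma busemann_le_defect:
  assumes \<omega>: "\<omega> \<in> boundary"
  obtains h where "h \<in> H" "busemann \<omega> h \<le> - int (defect \<omega> n)"
proof
  let ?x = "walk H (bd_prefix n \<omega>)"
  let ?r = "inv_word (tree_word ?x)"
  let ?h = "freely_reduce (bd_prefix n \<omega> @ ?r)"
  have x: "?x \<in> V" by (simp add: walk_in_V H_in_V)
  show h: "?h \<in> H" using walk_back[OF x] by (simp flip: walk_H_eq_H_iff)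
  \<comment> \<open>The Busemann formula asks for a prefix at least as long as \<open>?h\<close>.
    Extending the first \<open>n\<close> letters makes these cancel.\<close>
  define N where "N = max n (length ?h)"
  have "freely_reduce (inv_word ?h @ bd_prefix N \<omega>) =
      freely_reduce (inv_word (bd_prefix n \<omega> @ ?r) @ bd_prefix N \<omega>)"
    by (intro freely_reduce_cong freely_reduce_inv_cong refl)
      (simp add: freely_reduce_reduced reduced_word_freely_reduce)
  also have "\<dots> = freely_reduce (tree_word ?x @ (inv_word (bd_prefix n \<omega>) @ bd_prefix n \<omega> @ map \<omega> [n..<N]))"
    using bd_prefix_append[of n N \<omega>]
    by (simp only: N_def max.cobounded1 inv_word_simps append_assoc)
  also have "\<dots> = freely_reduce (tree_word ?x @ map \<omega> [n..<N])"
    by (intro freely_reduce_cong refl freely_reduce_cancel_inv)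
  finally have "length (freely_reduce (inv_word ?h @ bd_prefix N \<omega>)) \<le> height ?x + (N - n)"
    using length_freely_reduce_le[of "tree_word ?x @ map \<omega> [n..<N]"] length_tree_word[OF x] by simp
  then show "busemann \<omega> ?h \<le> - int (defect \<omega> n)"
    using length_freely_reduce_busemann[OF \<omega> reduced_word_freely_reduce, of "bd_prefix n \<omega> @ ?r" N]
      int_defect[of \<omega> n] by (simp add: N_def of_nat_diff)
qed

text \<open>By the two preceding bounds, the Busemann function is unbounded below on
  \<open>H\<close> exactly when the defect is unbounded.\<close>

lemma small_horospheric_iff:
  assumes \<omega>: "\<omega> \<in> boundary"
  shows "\<omega> \<in> small_horospheric H \<longleftrightarrow> (\<forall>C. \<exists>n. defect \<omega> n > C)"
proof
  assume small: "\<omega> \<in> small_horospheric H"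
  show "\<forall>C. \<exists>n. defect \<omega> n > C"
  proof (rule ccontr)
    assume "\<not> ?thesis"
    then obtain C where C: "\<And>n. defect \<omega> n \<le> C" by (meson not_le)
    \<comment> \<open>This horoball has level \<open>- int (Suc C)\<close>, whereas the Busemann
      values on \<open>H\<close> are at least \<open>- int C\<close>.\<close>
    have "H \<inter> horoball \<omega> (bd_prefix (Suc C) \<omega>) = {}"
    proof -
      have "busemann \<omega> h > - int (Suc C)" if "h \<in> H" for h
        using busemann_ge_defect[OF \<omega> that order_refl] C[of "length h"] by linarith
      then show ?thesis by (force simp: horoball_def busemann_bd_prefix[OF \<omega>])
    qed
    moreover have "\<forall>g\<in>carrier free_group. infinite (H \<inter> horoball \<omega> g)"
      using small by (simp add: small_horospheric_def)
    ultimately show False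
      using reduced_bd_prefix[OF \<omega>, of "Suc C"] by (metis finite.emptyI free_group_simps(1))
  qed
next
  assume unb: "\<forall>C. \<exists>n. defect \<omega> n > C"
  have "infinite (H \<inter> horoball \<omega> g)" for g
  proof
    assume fin: "finite (H \<inter> horoball \<omega> g)"
    \<comment> \<open>Including \<open>g\<close> keeps the set nonempty and puts every element with
      value below \<open>c\<close> into the horoball, which contradicts minimality.\<close>
    define c where "c = Min (busemann \<omega> ` insert g (H \<inter> horoball \<omega> g))"
    have c: "c \<le> busemann \<omega> h" if "h \<in> insert g (H \<inter> horoball \<omega> g)" for h
      unfolding c_def using that fin by (intro Min_le) auto
    obtain n where n: "defect \<omega> n > nat \<bar>c\<bar>" using unb by blast
    obtain h where h: "h \<in> H" "busemann \<omega> h \<le> - int (defect \<omega> n)"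
      using busemann_le_defect[OF \<omega>] .
    have "busemann \<omega> h < c" using h n by linarith
    moreover from this have "h \<in> H \<inter> horoball \<omega> g"
      using h(1) c[of g] H_reduced[OF h(1)] by (auto simp: horoball_def)
    ultimately show False using c[of h] by auto
  qed
  then show "\<omega> \<in> small_horospheric H" using \<omega> by (simp add: small_horospheric_def)
qed

text \<open>After the last crossing the path is a reduced tree walk. It cancels with the tree word
  of its start by a bounded amount, so the height grows like \<open>n\<close> up to a
  constant.\<close>

lemma defect_bounded_if_finite_crossings:
  assumes \<omega>: "\<omega> \<in> boundary" and fin: "finite (crossings \<omega>)"
  obtains C where "\<And>n. defect \<omega> n \<le> C"
proof -
  obtain N where N: "\<And>i. i \<in> crossings \<omega> \<Longrightarrow> i < N"
    using fin by (meson finite_nat_set_iff_bounded)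
  let ?x = "walk H (bd_prefix N \<omega>)"
  have x: "?x \<in> V" by (simp add: walk_in_V H_in_V)
  have "defect \<omega> n \<le> N + height ?x" for n
  proof (cases "n \<ge> N")
    case True
    have tw: "tree_walk ?x (map \<omega> [N..<n])" "walk ?x (map \<omega> [N..<n]) = walk H (bd_prefix n \<omega>)"
      using tree_walk_segment[OF True, of \<omega>] N by (metis not_le)+
    have "tree_word (walk H (bd_prefix n \<omega>)) = freely_reduce (tree_word ?x @ map \<omega> [N..<n])"
      using tree_word_walk[OF x tw(1)] tw(2) by simp
    then have "height (walk H (bd_prefix n \<omega>)) = length (freely_reduce (tree_word ?x @ map \<omega> [N..<n]))"
      using length_tree_word[of "walk H (bd_prefix n \<omega>)"] by (simp add: walk_in_V H_in_V)
    moreover have "length (freely_reduce (map \<omega> [N..<n])) \<le>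
        length (tree_word ?x) + length (freely_reduce (tree_word ?x @ map \<omega> [N..<n]))"
      by (rule length_freely_reduce_append)
    ultimately have "n - N \<le> height ?x + height (walk H (bd_prefix n \<omega>))"
      using reduced_segment[OF \<omega> True] length_tree_word[OF x] by (simp add: freely_reduce_reduced)
    then show ?thesis unfolding defect_def by linarith
  qed (use height_bd_prefix(2)[of \<omega> n] in simp)
  then show thesis using that by blast
qed

lemma small_horospheric_subset_schreier: "small_horospheric H \<subseteq> schreier_limit_set H T"
proof
  fix \<omega> assume small: "\<omega> \<in> small_horospheric H"
  then have \<omega>: "\<omega> \<in> boundary" by (simp add: small_horospheric_def)
  have "infinite (crossings \<omega>)"
    using defect_bounded_if_finite_crossings[OF \<omega>] small small_horospheric_iff[OF \<omega>] by (meson not_le)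
  then show "\<omega> \<in> schreier_limit_set H T" using \<omega> by (simp add: schreier_limit_set_eq)
qed

text \<open>A bounded nondecreasing defect is eventually constant, and then the height rises by one
  at each step.\<close>

lemma eventually_outward:
  assumes \<omega>: "\<omega> \<in> boundary" and "\<omega> \<notin> small_horospheric H"
  obtains N where "\<And>n. n \<ge> N \<Longrightarrow>
    height (walk H (bd_prefix (Suc n) \<omega>)) = Suc (height (walk H (bd_prefix n \<omega>)))"
proof -
  obtain C where "\<And>n. defect \<omega> n \<le> C"
    using assms small_horospheric_iff by (meson not_le)
  then obtain N where N: "\<And>n. n \<ge> N \<Longrightarrow> defect \<omega> n = defect \<omega> N"
    using bounded_mono_nat_eventually_const[of "defect \<omega>" C] defect_mono by metis
  show thesis
  proof
    fix n assume "n \<ge> N"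
    then show "height (walk H (bd_prefix (Suc n) \<omega>)) = Suc (height (walk H (bd_prefix n \<omega>)))"
      using N[of n] N[of "Suc n"] int_defect[of \<omega> n] int_defect[of \<omega> "Suc n"] by simp
  qed
qed

end

section \<open>The uniform measure\<close>

lemma openin_cylinder: "openin boundary_topology (cylinder w)"
proof -
  let ?S = "\<lambda>i. if i < length w then {w ! i} else UNIV"
  have "finite {i. ?S i \<noteq> UNIV}" by (rule finite_subset[of _ "{..<length w}"]) auto
  then have "openin (product_topology (\<lambda>_. discrete_topology UNIV) UNIV) (PiE UNIV ?S)"
    by (auto simp: openin_PiE_gen)
  moreover have "cylinder w = PiE UNIV ?S \<inter> boundary"
  proof -
    have "x i \<in> ?S i \<longleftrightarrow> (i < length w \<longrightarrow> x i = w ! i)" for x i by simp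
    then show ?thesis by (auto simp: cylinder_def PiE_iff)
  qed
  ultimately show ?thesis by (auto simp: boundary_topology_def openin_subtopology)
qed

lemma cylinder_disjoint_or_prefix:
  assumes "\<omega> \<in> cylinder u" "\<omega> \<in> cylinder v" "length u \<le> length v"
  shows "u = take (length u) v"
  using assms by (auto simp: cylinder_eq) (metis take_bd_prefix)

definition words :: "nat \<Rightarrow> 'a letter list set" where
  "words n = {w. length w = n \<and> reduced_word w}"

lemma finite_words [simp]: "finite (words n :: 'a::finite letter list set)"
  by (rule finite_subset[OF _ finite_lists_length_eq[of UNIV n]]) (auto simp: words_def)

lemma words_Suc: "words (Suc n) = (\<lambda>(w, a). w @ [a]) ` (SIGMA w:words n. {a. reduced_word (w @ [a])})"
proof (intro equalityI subsetI)
  fix w :: "'a letter list" assume w: "w \<in> words (Suc n)"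
  then obtain v a where "w = v @ [a]" by (cases w rule: rev_cases) (auto simp: words_def)
  with w show "w \<in> (\<lambda>(w, a). w @ [a]) ` (SIGMA w:words n. {a. reduced_word (w @ [a])})"
    by (intro image_eqI[of _ _ "(v, a)"]) (auto simp: words_def reduced_word_append)
qed (auto simp: words_def)

lemma sum_words_Suc:
  "(\<Sum>w\<in>words (Suc n). f w) =
    (\<Sum>w\<in>words n. \<Sum>a\<in>{a :: 'a::finite letter. reduced_word (w @ [a])}. f (w @ [a]))"
  unfolding words_Suc
  by (subst sum.reindex) (auto simp: inj_on_def sum.Sigma case_prod_unfold)

lemma card_extensions:
  assumes "w \<noteq> []" "reduced_word w"
  shows "card {a :: 'a::finite letter. reduced_word (w @ [a])} = 2 * CARD('a) - 1"
proof -
  have "{a. reduced_word (w @ [a])} = UNIV - {inv_letter (last w)}"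
    using assms by (auto simp: reduced_word_append)
  then show ?thesis by (simp add: card_Diff_singleton mult.commute)
qed

text \<open>The sum becomes the limit of one increasing sequence of finite sums, as measurability
  and monotone convergence require.\<close>

lemma infsum_ennreal_SUP_nat:
  fixes f :: "'i::countable \<Rightarrow> ennreal"
  shows "infsum f A = (SUP n. sum f {i\<in>A. to_nat i < n})"
proof -
  have fin: "finite {i\<in>A. to_nat i < n}" for n
    by (rule finite_subset[OF _ finite_vimageI[OF finite_lessThan[of n] inj_to_nat]]) auto
  have "(SUP F\<in>{F. finite F \<and> F \<subseteq> A}. sum f F) = (SUP n. sum f {i\<in>A. to_nat i < n})"
  proof (rule antisym)
    show "(SUP n. sum f {i\<in>A. to_nat i < n}) \<le> (SUP F\<in>{F. finite F \<and> F \<subseteq> A}. sum f F)"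
      using fin by (intro SUP_least SUP_upper) auto
    show "(SUP F\<in>{F. finite F \<and> F \<subseteq> A}. sum f F) \<le> (SUP n. sum f {i\<in>A. to_nat i < n})"
    proof (rule SUP_least)
      fix F assume F: "F \<in> {F. finite F \<and> F \<subseteq> A}"
      then have "finite (to_nat ` F)" by simp
      then obtain n where "\<forall>k\<in>to_nat ` F. k < n"
        unfolding finite_nat_set_iff_bounded by blast
      then have "sum f F \<le> sum f {i\<in>A. to_nat i < n}"
        using F fin by (intro sum_mono2) auto
      then show "sum f F \<le> (SUP n. sum f {i\<in>A. to_nat i < n})"
        by (rule SUP_upper2[OF UNIV_I])
    qed
  qed
  then show ?thesis unfolding nonneg_infsum_complete[OF zero_le] .
qed

lemma infinite_iff_to_nat_unbounded:
  fixes S :: "'i::countable set"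
  shows "infinite S \<longleftrightarrow> (\<forall>m. \<exists>i\<in>S. to_nat i \<ge> m)"
proof -
  have "infinite S \<longleftrightarrow> infinite (to_nat ` S)"
    using finite_imageD[OF _ inj_on_subset[OF inj_to_nat]] by blast
  also have "\<dots> \<longleftrightarrow> (\<forall>m. \<exists>i\<in>S. to_nat i \<ge> m)"
    unfolding infinite_nat_iff_unbounded_le by (simp add: Bex_def image_iff) blast
  finally show ?thesis .
qed

section \<open>Cylinder weights and measurability of prefixes\<close>

locale boundary_measure =
  fixes M :: "(nat \<Rightarrow> 'a::finite letter) measure"
  assumes uniform_M: "uniform_measure_on_boundary M" and card_ge_2: "CARD('a) \<ge> 2"
begin

sublocale prob_space M
  using uniform_M by (simp add: uniform_measure_on_boundary_def)

lemma sets_M: "sets M = sigma_sets boundary {U. openin boundary_topology U}"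
proof -
  have "{U. openin boundary_topology U} \<subseteq> Pow (boundary :: (nat \<Rightarrow> 'a letter) set)"
    by (auto simp: boundary_topology_def openin_subtopology)
  then show ?thesis
    using uniform_M by (simp add: uniform_measure_on_boundary_def)
qed

lemma space_M: "space M = boundary"
proof -
  have "sets M = sets (sigma boundary {U. openin boundary_topology U})"
    using uniform_M by (simp add: uniform_measure_on_boundary_def)
  from sets_eq_imp_space_eq[OF this] show ?thesis by (simp add: space_measure_of_conv)
qed

lemma sets_cylinder [measurable]: "cylinder w \<in> sets M"
  unfolding sets_M by (intro sigma_sets.Basic) (simp add: openin_cylinder)

definition q :: real where "q = 2 * real CARD('a) - 1"

lemma q_ge_3: "q \<ge> 3"
  using card_ge_2 by (simp add: q_def)

definition weight :: "'a letter list \<Rightarrow> real" where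
  "weight w = measure M (cylinder w)"

lemma weight_nonneg [simp]: "weight w \<ge> 0"
  by (simp add: weight_def)

lemma weight_eq:
  assumes "reduced_word w" "w \<noteq> []"
  shows "weight w = 1 / ((q + 1) * q ^ (length w - 1))"
proof -
  have "weight w = 1 / (2 * real CARD('a) * (2 * real CARD('a) - 1) ^ (length w - 1))"
    using uniform_M assms unfolding uniform_measure_on_boundary_def weight_def by simp
  then show ?thesis by (simp add: q_def)
qed

lemma weight_snoc:
  assumes "reduced_word (w @ [a])" "w \<noteq> []"
  shows "weight (w @ [a]) = weight w / q"
proof -
  have "reduced_word w" using assms by (simp add: reduced_word_append)
  moreover have "q ^ length w = q ^ (length w - 1) * q"
    using assms(2) by (cases w) simp_all
  ultimately show ?thesis using assms by (simp add: weight_eq)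
qed

text \<open>Prefixes take countably many values and their fibres are cylinders or empty, so every
  function of a prefix is measurable.\<close>

lemma measurable_bd_prefix [measurable]: "bd_prefix n \<in> M \<rightarrow>\<^sub>M count_space UNIV"
proof (subst measurable_count_space_eq2_countable, intro conjI ballI)
  fix w :: "'a letter list"
  have "bd_prefix n -` {w} \<inter> space M = (if length w = n then cylinder w else {})"
    by (auto simp: cylinder_eq space_M)
  then show "bd_prefix n -` {w} \<inter> space M \<in> sets M" by simp
qed simp

lemma measurable_prefix_fun: "(\<lambda>\<omega>. f (bd_prefix n \<omega>)) \<in> M \<rightarrow>\<^sub>M count_space UNIV"
  by measurable

lemma pred_prefix: "Measurable.pred M (\<lambda>\<omega>. P (bd_prefix n \<omega>))"
  by measurable

lemma measure_prefix:
  "measure M {\<omega> \<in> space M. P (bd_prefix n \<omega>)} = (\<Sum>w | w \<in> words n \<and> P w. weight w)"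
proof -
  have "{\<omega> \<in> space M. P (bd_prefix n \<omega>)} = (\<Union>w\<in>{w \<in> words n. P w}. cylinder w)"
    using reduced_bd_prefix by (auto simp: space_M cylinder_eq words_def)
  moreover have "disjoint_family_on cylinder {w \<in> words n. P w}"
    by (auto simp: disjoint_family_on_def cylinder_eq words_def)
  ultimately show ?thesis
    by (simp add: finite_measure_finite_Union weight_def image_subset_iff)
qed

lemma sum_weight_words: "(\<Sum>w\<in>words n. weight w) = 1"
  using measure_prefix[of "\<lambda>_. True" n] by (simp add: prob_space)

lemma measurable_busemann [measurable]:
  assumes "reduced_word h"
  shows "(\<lambda>\<omega>. busemann \<omega> h) \<in> M \<rightarrow>\<^sub>M count_space UNIV"
proof -
  have "busemann \<omega> h = int (length (freely_reduce (inv_word h @ bd_prefix (length h) \<omega>))) - int (length h)"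
    if "\<omega> \<in> space M" for \<omega>
    using length_freely_reduce_busemann[OF _ assms order_refl, of \<omega>] that by (simp add: space_M)
  then show ?thesis
    by (subst measurable_cong) (auto intro: measurable_prefix_fun)
qed

end

section \<open>Comparison of the limit sets\<close>

locale schreier_boundary = schreier_tree H T + boundary_measure M
  for H :: "'a::finite letter list set" and T :: "'a edge set" and M :: "(nat \<Rightarrow> 'a letter) measure"
begin

section \<open>Outward paths with infinitely many crossings are negligible\<close>

definition outward :: "nat \<Rightarrow> 'a letter list \<Rightarrow> bool" where
  "outward N w \<longleftrightarrow> (\<forall>i. N \<le> i \<and> i < length w \<longrightarrow>
     height (walk H (take (Suc i) w)) = Suc (height (walk H (take i w))))"

definition word_crossings :: "nat \<Rightarrow> 'a letter list \<Rightarrow> nat set" where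
  "word_crossings N w = {i. N \<le> i \<and> i < length w \<and> (walk H (take i w), w ! i) \<notin> T}"

lemma outward_snoc:
  "outward N (w @ [a]) \<longleftrightarrow> outward N w \<and>
     (N \<le> length w \<longrightarrow> height (step (walk H w) a) = Suc (height (walk H w)))"
  by (auto simp: outward_def less_Suc_eq)

lemma finite_word_crossings [simp]: "finite (word_crossings N w)"
  by (rule finite_subset[of _ "{..<length w}"]) (auto simp: word_crossings_def)

lemma word_crossings_snoc:
  "word_crossings N (w @ [a]) = word_crossings N w \<union>
     (if N \<le> length w \<and> (walk H w, a) \<notin> T then {length w} else {})"
  by (auto simp: word_crossings_def less_Suc_eq nth_append)

lemma card_word_crossings_snoc:
  "card (word_crossings N (w @ [a])) = card (word_crossings N w) +
     (if N \<le> length w \<and> (walk H w, a) \<notin> T then 1 else 0)"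
proof -
  have "length w \<notin> word_crossings N w" by (simp add: word_crossings_def)
  then show ?thesis by (simp add: word_crossings_snoc)
qed

text \<open>After an outward edge outside the tree, the tree edge towards the origin is one of the
  \<open>q\<close> possible continuations. This discount makes the expectation of \<open>gain\<close> nonincreasing.\<close>

definition gain :: "nat \<Rightarrow> 'a letter list \<Rightarrow> real" where
  "gain N w = (if outward N w then (q / (q - 1)) ^ card (word_crossings N (butlast w)) else 0)"

lemma gain_nonneg: "gain N w \<ge> 0"
  using q_ge_3 by (simp add: gain_def)

text \<open>A one-step supermartingale inequality. The last edge of \<open>w\<close> enters the
  count only now: inside the tree it leaves the count unchanged, and outside it the new factor is
  offset by the loss of one extension.\<close>

lemma sum_gain_extensions:
  assumes w: "w \<in> words n" and n: "N < n"
  shows "(\<Sum>a | reduced_word (w @ [a]). weight (w @ [a]) * gain N (w @ [a])) \<le> weight w * gain N w"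
proof (cases "outward N w")
  case False
  then show ?thesis by (simp add: gain_def outward_snoc)
next
  case True
  have w_red: "reduced_word w" and len: "length w = n" and ne: "w \<noteq> []" using w n by (auto simp: words_def)
  let ?E = "{a. reduced_word (w @ [a])}"
  let ?A = "{a \<in> ?E. outward N (w @ [a])}"
  obtain v c where v: "w = v @ [c]" using ne by (cases w rule: rev_cases) auto
  define x where "x = walk H v"
  have x: "x \<in> V" by (simp add: x_def walk_in_V H_in_V)
  let ?y = "walk H w"
  have y: "?y = step x c" by (simp add: v x_def)
  let ?t = "q / (q - 1)"
  let ?c = "card (word_crossings N v)"
  have vlen: "N \<le> length v" using len n v by simp
  have "real (card ?E) = q"
    using card_extensions[OF ne w_red] card_ge_2 by (simp add: q_def of_nat_diff)
  have cardA: "real (card ?A) * ?t ^ card (word_crossings N w) \<le> q * ?t ^ ?c"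
  proof (cases "(x, c) \<in> T")
    case True
    have "card ?A \<le> card ?E" by (intro card_mono) auto
    moreover have "card (word_crossings N w) = ?c"
      using True card_word_crossings_snoc[of N v c] by (simp add: v x_def)
    ultimately show ?thesis
      using \<open>real (card ?E) = q\<close> q_ge_3 by (intro mult_mono) auto
  next
    case False
    have "height ?y = Suc (height x)"
      using True vlen unfolding v outward_snoc by (simp add: x_def)
    then obtain b where b: "(?y, b) \<in> T" "height (step ?y b) < height ?y"
      using lower_tree_edge[of ?y] x by (auto simp: y step_in_V)
    \<comment> \<open>The path arrived by an edge outside the tree, so descending along the tree
      edge \<open>b\<close> is not backtracking.\<close>
    have "(?y, inv_letter c) \<notin> T" using False T_reverse_iff[OF x, of c] by (simp add: y)
    then have "b \<noteq> inv_letter c" using b(1) by auto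
    then have "b \<in> ?E" using w_red v reduced_word_append[of w "[b]"] by simp
    moreover have "b \<notin> ?A" using b(2) len n by (simp add: outward_snoc)
    ultimately have "?A \<subset> ?E" by blast
    then have "card ?A < card ?E" by (intro psubset_card_mono) auto
    then have "real (card ?A) \<le> q - 1" using \<open>real (card ?E) = q\<close> by linarith
    moreover have "card (word_crossings N w) = Suc ?c"
      using False vlen card_word_crossings_snoc[of N v c] by (simp add: v x_def)
    ultimately have "real (card ?A) * ?t ^ card (word_crossings N w) \<le> (q - 1) * (?t ^ Suc ?c)"
      using q_ge_3 by (intro mult_mono) auto
    also have "\<dots> = q * ?t ^ ?c" using q_ge_3 by simp
    finally show ?thesis .
  qed
  have "(\<Sum>a\<in>?E. weight (w @ [a]) * gain N (w @ [a])) =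
      (\<Sum>a\<in>?A. weight (w @ [a]) * gain N (w @ [a]))"
    by (intro sum.mono_neutral_right) (auto simp: gain_def)
  also have "\<dots> = (\<Sum>a\<in>?A. weight w / q * ?t ^ card (word_crossings N w))"
    by (intro sum.cong) (auto simp: gain_def weight_snoc ne)
  also have "\<dots> = weight w / q * (real (card ?A) * ?t ^ card (word_crossings N w))" by simp
  also have "\<dots> \<le> weight w / q * (q * ?t ^ ?c)"
    using q_ge_3 by (intro mult_left_mono cardA) simp
  also have "\<dots> = weight w * gain N w" using q_ge_3 True by (simp add: gain_def v)
  finally show ?thesis by simp
qed

text \<open>At length \<open>Suc N\<close> no crossing is counted yet, as \<open>butlast w\<close>
  has length \<open>N\<close>. From there the one-step inequality is iterated.\<close>

lemma sum_gain_le_1: "(\<Sum>w\<in>words (Suc N + n). weight w * gain N w) \<le> 1"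
proof (induction n)
  case 0
  have "weight w * gain N w \<le> weight w" if "w \<in> words (Suc N)" for w
  proof -
    have "word_crossings N (butlast w) = {}" using that by (auto simp: word_crossings_def words_def)
    then have "gain N w \<le> 1" by (simp add: gain_def)
    then show ?thesis using mult_left_mono[of "gain N w" 1 "weight w"] by simp
  qed
  then have "(\<Sum>w\<in>words (Suc N). weight w * gain N w) \<le> (\<Sum>w\<in>words (Suc N). weight w)"
    by (rule sum_mono)
  then show ?case by (simp add: sum_weight_words)
next
  case (Suc n)
  have "(\<Sum>w\<in>words (Suc (Suc N + n)). weight w * gain N w) \<le>
      (\<Sum>w\<in>words (Suc N + n). weight w * gain N w)"
    unfolding sum_words_Suc by (intro sum_mono sum_gain_extensions[of _ "Suc N + n"]) simp_all
  with Suc show ?case by simp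
qed

lemma crossings_bd_prefix:
  "i < n \<Longrightarrow> N \<le> i \<Longrightarrow> i \<in> word_crossings N (bd_prefix n \<omega>) \<longleftrightarrow> i \<in> crossings \<omega>"
  by (simp add: word_crossings_def crossings_def)

lemma outward_bd_prefix:
  assumes "\<And>n. n \<ge> N \<Longrightarrow>
    height (walk H (bd_prefix (Suc n) \<omega>)) = Suc (height (walk H (bd_prefix n \<omega>)))"
  shows "outward N (bd_prefix n \<omega>)"
  using assms by (auto simp: outward_def)

lemma pred_crossings: "Measurable.pred M (\<lambda>\<omega>. n \<in> crossings \<omega>)"
  using pred_prefix[of "\<lambda>w. (walk H (butlast w), last w) \<notin> T" "Suc n"]
  by (simp add: crossings_def bd_prefix_Suc)

lemma pred_infinite_crossings: "Measurable.pred M (\<lambda>\<omega>. infinite (crossings \<omega>))"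
  unfolding infinite_nat_iff_unbounded_le using pred_crossings by measurable

text \<open>By Markov's inequality for \<open>gain\<close>, being outward with at least
  \<open>k\<close> counted crossings has probability at most the \<open>k\<close>-th power of
  \<open>(q - 1) / q\<close>.\<close>

lemma outward_infinite_crossings_null:
  "AE \<omega> in M. \<not> ((\<forall>n. outward N (bd_prefix n \<omega>)) \<and> infinite (crossings \<omega>))"
proof -
  define B where "B = {\<omega> \<in> space M. (\<forall>n. outward N (bd_prefix n \<omega>)) \<and> infinite (crossings \<omega>)}"
  have outw: "Measurable.pred M (\<lambda>\<omega>. outward N (bd_prefix n \<omega>))" for n by (rule pred_prefix)
  have B[measurable]: "B \<in> sets M"
    unfolding B_def using pred_infinite_crossings outw by measurable
  let ?t = "q / (q - 1)"
  have t: "?t > 1" using q_ge_3 by simp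
  have bound: "measure M B \<le> (1 / ?t) ^ k" for k
  proof -
    define P where "P n w \<longleftrightarrow> outward N w \<and> card (word_crossings N (butlast w)) \<ge> k" for n :: nat and w
    define E where "E n = {\<omega> \<in> space M. P n (bd_prefix (Suc N + n) \<omega>)}" for n
    have E[measurable]: "E n \<in> sets M" for n
      unfolding E_def by (intro predE pred_prefix)
    have mE: "measure M (E n) \<le> (1 / ?t) ^ k" for n
    proof -
      have "measure M (E n) = (\<Sum>w | w \<in> words (Suc N + n) \<and> P n w. weight w)"
        unfolding E_def by (rule measure_prefix)
      also have "\<dots> \<le> (\<Sum>w | w \<in> words (Suc N + n) \<and> P n w. (1 / ?t) ^ k * (weight w * gain N w))"
      proof (rule sum_mono)
        fix w assume "w \<in> {w. w \<in> words (Suc N + n) \<and> P n w}"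
        then have "?t ^ k \<le> gain N w"
          using t by (auto simp: P_def gain_def intro!: power_increasing)
        then have "(1 / ?t) ^ k * ?t ^ k \<le> (1 / ?t) ^ k * gain N w"
          using q_ge_3 by (intro mult_left_mono) auto
        moreover have "(1 / ?t) ^ k * ?t ^ k = 1" using q_ge_3 by (simp flip: power_mult_distrib)
        ultimately have "1 \<le> (1 / ?t) ^ k * gain N w" by simp
        from mult_left_mono[OF this weight_nonneg[of w]]
        show "weight w \<le> (1 / ?t) ^ k * (weight w * gain N w)" by (simp only: mult_ac mult_1_right)
      qed
      also have "\<dots> \<le> (\<Sum>w\<in>words (Suc N + n). (1 / ?t) ^ k * (weight w * gain N w))"
        using q_ge_3 gain_nonneg by (intro sum_mono2) auto
      also have "\<dots> = (1 / ?t) ^ k * (\<Sum>w\<in>words (Suc N + n). weight w * gain N w)"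
        by (simp only: sum_distrib_left)
      also have "\<dots> \<le> (1 / ?t) ^ k * 1"
        using q_ge_3 sum_gain_le_1 by (intro mult_left_mono) auto
      finally show ?thesis by simp
    qed
    have butl: "butlast (bd_prefix (Suc N + n) \<omega>) = bd_prefix (N + n) \<omega>" for n \<omega>
      by (simp add: bd_prefix_Suc)
    \<comment> \<open>On \<open>B\<close> the path is outward at all times after \<open>N\<close>,
      and the number of counted crossings can only grow.\<close>
    have "incseq (\<lambda>n. B \<inter> E n)"
    proof (rule incseq_SucI)
      fix n
      have "word_crossings N (bd_prefix (N + n) \<omega>) \<subseteq> word_crossings N (bd_prefix (N + Suc n) \<omega>)" for \<omega>
        by (auto simp: word_crossings_def)
      from card_mono[OF finite_word_crossings this]
      show "B \<inter> E n \<subseteq> B \<inter> E (Suc n)"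
        unfolding B_def E_def P_def butl by (auto intro: order_trans)
    qed
    then have "(\<lambda>n. measure M (B \<inter> E n)) \<longlonglongrightarrow> measure M (\<Union>n. B \<inter> E n)"
      by (intro finite_Lim_measure_incseq) auto
    moreover have "(\<Union>n. B \<inter> E n) = B"
    proof -
      have "\<exists>n. \<omega> \<in> E n" if \<omega>: "\<omega> \<in> B" for \<omega>
      proof -
        have "infinite (crossings \<omega> - {..<N})" using \<omega> by (simp add: B_def)
        then obtain F where F: "F \<subseteq> crossings \<omega> - {..<N}" "finite F" "card F = k"
          using infinite_arbitrarily_large by blast
        then obtain n where "\<forall>i\<in>F. i < n" unfolding finite_nat_set_iff_bounded by blast
        have "F \<subseteq> word_crossings N (bd_prefix (N + n) \<omega>)"
        proof
          fix i assume "i \<in> F"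
          then have "i < N + n" "N \<le> i" "i \<in> crossings \<omega>"
            using F(1) \<open>\<forall>i\<in>F. i < n\<close> by auto
          then show "i \<in> word_crossings N (bd_prefix (N + n) \<omega>)" by (simp add: crossings_bd_prefix)
        qed
        from card_mono[OF finite_word_crossings this] F(3) \<omega> have "\<omega> \<in> E n"
          unfolding E_def P_def butl B_def by simp
        then show ?thesis ..
      qed
      then show ?thesis by blast
    qed
    moreover have "measure M (B \<inter> E n) \<le> (1 / ?t) ^ k" for n
      using finite_measure_mono[of "B \<inter> E n" "E n"] mE[of n] by simp
    ultimately show ?thesis by (intro LIMSEQ_le_const2[of "\<lambda>n. measure M (B \<inter> E n)"]) auto
  qed
  have "(\<lambda>k. (1 / ?t) ^ k) \<longlonglongrightarrow> 0" using t q_ge_3 by (intro LIMSEQ_realpow_zero) auto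
  then have "measure M B \<le> 0" using bound by (intro LIMSEQ_le_const) auto
  then have "B \<in> null_sets M" using B by (intro null_setsI) (simp_all add: emeasure_eq_measure measure_le_0_iff)
  then show ?thesis by (auto simp: B_def dest!: AE_not_in)
qed

lemma schreier_limit_set_AE_small:
  "AE \<omega> in M. \<omega> \<in> schreier_limit_set H T \<longrightarrow> \<omega> \<in> small_horospheric H"
proof -
  have "AE \<omega> in M. \<forall>N. \<not> ((\<forall>n. outward N (bd_prefix n \<omega>)) \<and> infinite (crossings \<omega>))"
    unfolding AE_all_countable using outward_infinite_crossings_null by blast
  then show ?thesis
  proof eventually_elim
    case (elim \<omega>)
    show ?case
    proof (intro impI, rule ccontr)
      assume \<omega>: "\<omega> \<in> schreier_limit_set H T" and "\<omega> \<notin> small_horospheric H"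
      then obtain N where "\<And>n. n \<ge> N \<Longrightarrow>
          height (walk H (bd_prefix (Suc n) \<omega>)) = Suc (height (walk H (bd_prefix n \<omega>)))"
        using eventually_outward[of \<omega>] by (auto simp: schreier_limit_set_eq)
      then have "\<forall>n. outward N (bd_prefix n \<omega>)" using outward_bd_prefix by blast
      then show False using elim \<omega> by (auto simp: schreier_limit_set_eq)
    qed
  qed
qed

section \<open>Tree rays and the disjointness of their translates\<close>

definition tree_ray_words :: "'a letter list \<Rightarrow> nat \<Rightarrow> 'a letter list set" where
  "tree_ray_words u m = {w \<in> words m. take (length u) w = u \<and>
     outward (length u) w \<and> word_crossings (length u) w = {}}"

text \<open>This is the set \<Delta> for the initial word \<open>u\<close>;
  \<open>tree_ray_words u m\<close> is its finite approximation at length \<open>m\<close>.\<close>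

definition tree_rays :: "'a letter list \<Rightarrow> (nat \<Rightarrow> 'a letter) set" where
  "tree_rays u = {\<omega> \<in> space M. \<forall>m\<ge>length u. bd_prefix m \<omega> \<in> tree_ray_words u m}"

lemma outward_height:
  assumes "outward N w" "N \<le> k" "k \<le> length w"
  shows "height (walk H (take k w)) = height (walk H (take N w)) + (k - N)"
  using assms(2,3)
proof (induction k rule: dec_induct)
  case (step k)
  then show ?case using assms(1) by (auto simp: outward_def Suc_diff_le)
qed simp

text \<open>Since the height grows at every step, nothing cancels in the tree word. The end vertex
  thus determines the whole ray after \<open>u\<close>.\<close>

lemma tree_ray_word_split:
  assumes w: "w \<in> tree_ray_words u m" "length u \<le> m"
  shows "tree_word (walk H w) = tree_word (walk H u) @ drop (length u) w"
proof -
  let ?N = "length u"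
  have len: "length w = m" and tk: "take ?N w = u" and out: "outward ?N w"
    and cr: "word_crossings ?N w = {}" using w by (auto simp: tree_ray_words_def words_def)
  have wu: "w = u @ drop ?N w" using tk by (metis append_take_drop_id)
  have ww: "walk (walk H u) (drop ?N w) = walk H w" using arg_cong[OF wu, of "walk H"] by simp
  have "tree_walk (walk H u) (drop ?N w)"
  proof
    fix e assume "e \<in> set (edges (walk H u) (drop ?N w))"
    then obtain i where i: "i < length (drop ?N w)" "e = edges (walk H u) (drop ?N w) ! i"
      by (auto simp: in_set_conv_nth)
    have "take (?N + i) w = u @ take i (drop ?N w)" using tk by (simp add: take_add)
    then have "e = (walk H (take (?N + i) w), w ! (?N + i))"
      using i nth_edges[of i "drop ?N w" "walk H u"] by simp
    moreover have "?N + i \<notin> word_crossings ?N w" using cr by simp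
    ultimately show "e \<in> T" using i(1) by (simp add: word_crossings_def)
  qed
  moreover have "height (walk (walk H u) (drop ?N w)) = height (walk H u) + length (drop ?N w)"
    using outward_height[OF out, of "length w"] w(2) len tk by (simp add: ww)
  ultimately show ?thesis
    using tree_word_walk_height[of "walk H u" "drop ?N w"] by (simp add: ww walk_in_V H_in_V)
qed

text \<open>Translation affects only an initial part of a long word. Removing the last
  \<open>j\<close> letters before or after it gives the same vertex.\<close>

lemma translate_take:
  assumes "h \<in> H" "reduced_word w" "j + length h \<le> length w"
  defines "p \<equiv> freely_reduce (inv_word h @ w)"
  shows "j \<le> length p" "walk H (take (length p - j) p) = walk H (take (length w - j) w)"
proof -
  let ?w = "take (length w - j) w" and ?s = "drop (length w - j) w"
  have "p = freely_reduce (inv_word h @ ?w) @ ?s"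
    using freely_reduce_append_long[of ?w ?s "inv_word h"] assms(2,3) by (simp add: p_def)
  moreover have "length ?s = j" using assms(3) by simp
  ultimately have "j \<le> length p" "take (length p - j) p = freely_reduce (inv_word h @ ?w)" by simp_all
  then show "j \<le> length p" "walk H (take (length p - j) p) = walk H ?w"
    by (simp_all only: walk_freely_reduce H_in_V walk_H_inv_word[OF assms(1)])
qed

text \<open>A translate of a long tree ray still ends with a long tree ray, and the heights along it
  determine where it ends.\<close>

lemma translate_prefix_unique:
  assumes h: "h1 \<in> H" "h2 \<in> H" "length h1 \<le> L" "length h2 \<le> L"
    and w: "w1 \<in> tree_ray_words u m" "w2 \<in> tree_ray_words u m" and m: "length u + 3 * L < m"
    and pre: "freely_reduce (inv_word h1 @ w1) =
      take (length (freely_reduce (inv_word h1 @ w1))) (freely_reduce (inv_word h2 @ w2))"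
    and le: "length (freely_reduce (inv_word h1 @ w1)) \<le> length (freely_reduce (inv_word h2 @ w2))"
  shows "h1 = h2 \<and> w1 = w2"
proof -
  let ?N = "length u"
  define p1 where "p1 = freely_reduce (inv_word h1 @ w1)"
  define p2 where "p2 = freely_reduce (inv_word h2 @ w2)"
  have len: "length w1 = m" "length w2 = m" and red: "reduced_word w1" "reduced_word w2"
    and tk: "take ?N w1 = u" "take ?N w2 = u" and out: "outward ?N w1" "outward ?N w2"
    using w by (auto simp: tree_ray_words_def words_def)
  \<comment> \<open>Both translates have length within \<open>L\<close> of \<open>m\<close>, so
    \<open>j\<close> is at most \<open>2 * L\<close>. Adding \<open>length h2\<close> accounts for
    the \<open>3 * L\<close> in the bound on \<open>m\<close>.\<close>
  define j where "j = length p2 - length p1"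
  have "m \<le> length h1 + length p1"
    using length_freely_reduce_append(2)[of w1 "inv_word h1"] red len by (simp add: p1_def freely_reduce_reduced)
  moreover have "length p2 \<le> length h2 + m"
    using length_freely_reduce_le[of "inv_word h2 @ w2"] len by (simp add: p2_def)
  ultimately have j: "j \<le> 2 * L" using h by (simp add: j_def)
  have p1: "walk H p1 = walk H w1"
    using translate_take(2)[OF h(1) red(1), of 0] h m len by (simp add: p1_def)
  have jh: "j + length h2 \<le> length w2" using j h m len by simp
  have p12: "p1 = take (length p2 - j) p2" using pre le by (simp add: p1_def p2_def j_def)
  \<comment> \<open>\<open>w1\<close> at time \<open>m\<close> and \<open>w2\<close> at time
    \<open>m - j\<close> reach the same vertex. After \<open>u\<close> the height rises by one per
    letter, so equal heights force \<open>j = 0\<close>.\<close>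
  have "walk H p1 = walk H (take (m - j) w2)"
    using translate_take(2)[OF h(2) red(2) jh] len by (subst p12) (simp add: p2_def)
  moreover have "height (walk H w1) = height (walk H u) + (m - ?N)"
    using outward_height[OF out(1), of m] m tk len by simp
  moreover have "height (walk H (take (m - j) w2)) = height (walk H u) + (m - j - ?N)"
    using outward_height[OF out(2), of "m - j"] m j tk len by simp
  ultimately have "m - ?N = m - j - ?N" using p1 by simp
  then have "j = 0" using m j by simp
  then have p: "p1 = p2" using p12 by simp
  have "walk H p2 = walk H w2"
    using translate_take(2)[OF h(2) red(2), of 0] h m len by (simp add: p2_def)
  then have "walk H w1 = walk H w2" using p1 p by simp
  then have "drop ?N w1 = drop ?N w2"
    using tree_ray_word_split[OF w(1)] tree_ray_word_split[OF w(2)] m by simp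
  then have ww: "w1 = w2" using tk by (metis append_take_drop_id)
  then have "freely_reduce (inv_word h1) = freely_reduce (inv_word h2)"
    using p unfolding p1_def p2_def by (intro freely_reduce_cancel_right[of "inv_word h1" w2]) simp
  then have "inv_word h1 = inv_word h2"
    using H_reduced[OF h(1)] H_reduced[OF h(2)] by (simp add: freely_reduce_reduced)
  then have "h1 = h2" by (metis inv_word_simps(4))
  with ww show ?thesis by simp
qed

text \<open>The factor \<open>q powi (- busemann \<omega> h)\<close> is the Jacobian of the translation by
  \<open>inv_word h\<close>, here on cylinders.\<close>

lemma weight_translate:
  assumes "\<omega> \<in> cylinder w" "h \<in> H" "reduced_word w" "length h < length w"
  shows "q powi (- busemann \<omega> h) * weight w = weight (freely_reduce (inv_word h @ w))"
proof -
  let ?p = "freely_reduce (inv_word h @ w)"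
  have w: "bd_prefix (length w) \<omega> = w" and \<omega>: "\<omega> \<in> boundary"
    using assms(1) by (auto simp: cylinder_eq)
  have b: "busemann \<omega> h = int (length ?p) - int (length w)"
    using length_freely_reduce_busemann[OF \<omega> H_reduced[OF assms(2)], of "length w"] assms(4) w by simp
  \<comment> \<open>This shows that the translate is nonempty, as required by the weight formula and
    by the truncated exponent \<open>length ?p - 1\<close>.\<close>
  have "length w \<le> length h + length ?p"
    using length_freely_reduce_append(2)[of w "inv_word h"] assms(3) by (simp add: freely_reduce_reduced)
  then have pos: "length ?p > 0" "length w > 0" using assms(4) by auto
  have jac: "q powi (int (length w) - int (length ?p)) * q ^ (length ?p - 1) = q ^ (length w - 1)"
  proof -
    have "q powi (int (length w) - int (length ?p)) * q ^ (length ?p - 1) =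
        q powi (int (length w) - int (length ?p)) * q powi int (length ?p - 1)"
      by simp
    also have "\<dots> = q powi (int (length w) - int (length ?p) + int (length ?p - 1))"
      using q_ge_3 by (subst power_int_add) auto
    also have "int (length w) - int (length ?p) + int (length ?p - 1) = int (length w - 1)"
      using pos by (simp add: of_nat_diff Suc_le_eq del: length_greater_0_conv)
    finally show ?thesis by simp
  qed
  have "weight ?p = 1 / ((q + 1) * q ^ (length ?p - 1))"
    using pos by (intro weight_eq) (simp_all add: reduced_word_freely_reduce)
  moreover have "weight w = 1 / ((q + 1) * q ^ (length w - 1))"
    using pos assms(3) by (intro weight_eq) simp_all
  moreover have "x * (1 / ((q + 1) * c)) = 1 / ((q + 1) * d)" if "x * d = c" "d > 0" "c > 0" for x c d
    using that q_ge_3 by (auto simp: divide_simps zero_less_mult_iff)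
  from this[OF jac] have "q powi (int (length w) - int (length ?p)) * (1 / ((q + 1) * q ^ (length w - 1))) =
      1 / ((q + 1) * q ^ (length ?p - 1))"
    using q_ge_3 by simp
  moreover have "- busemann \<omega> h = int (length w) - int (length ?p)" by (simp add: b)
  ultimately show ?thesis by (simp only:)
qed

text \<open>Distinct translates are never prefixes of one another, so their cylinders are disjoint
  and the weights add up to a probability.\<close>

lemma sum_translates_le_1:
  assumes K: "finite K" "K \<subseteq> H" and L: "\<And>h. h \<in> K \<Longrightarrow> length h \<le> L" and m: "length u + 3 * L < m"
  shows "(\<Sum>(h, w)\<in>K \<times> tree_ray_words u m. weight (freely_reduce (inv_word h @ w))) \<le> 1"
proof -
  let ?I = "K \<times> tree_ray_words u m"
  let ?p = "\<lambda>(h, w). freely_reduce (inv_word h @ w)"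
  have "finite (tree_ray_words u m)"
    by (rule finite_subset[OF _ finite_words[of m]]) (auto simp: tree_ray_words_def)
  then have fin: "finite ?I" using K by simp
  have "disjoint_family_on (\<lambda>i. cylinder (?p i)) ?I"
    unfolding disjoint_family_on_def
  proof (intro ballI impI)
    fix i j assume ij: "i \<in> ?I" "j \<in> ?I" "i \<noteq> j"
    have *: "i = j" if "i \<in> ?I" "j \<in> ?I" "\<omega> \<in> cylinder (?p i)" "\<omega> \<in> cylinder (?p j)"
        "length (?p i) \<le> length (?p j)" for i j \<omega>
    proof -
      obtain h1 w1 h2 w2 where i: "i = (h1, w1)" and j: "j = (h2, w2)" by (metis surj_pair)
      show ?thesis
        using that cylinder_disjoint_or_prefix[OF that(3-5)] K L m
          translate_prefix_unique[of h1 h2 L w1 u m w2] by (auto simp: i j)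
    qed
    show "cylinder (?p i) \<inter> cylinder (?p j) = {}"
    proof (rule ccontr)
      assume "\<not> ?thesis"
      then obtain \<omega> where \<omega>: "\<omega> \<in> cylinder (?p i)" "\<omega> \<in> cylinder (?p j)" by blast
      show False
      proof (cases "length (?p i) \<le> length (?p j)")
        case True
        then show False using *[OF ij(1,2) \<omega>] ij(3) by blast
      next
        case False
        then show False using *[OF ij(2,1) \<omega>(2,1)] ij(3) by force
      qed
    qed
  qed
  then have "measure M (\<Union>i\<in>?I. cylinder (?p i)) = (\<Sum>i\<in>?I. weight (?p i))"
    using fin by (subst finite_measure_finite_Union) (auto simp: weight_def)
  then show ?thesis using prob_le_1[of "\<Union>i\<in>?I. cylinder (?p i)"] by (simp add: case_prod_unfold)
qed

lemma sets_tree_rays [measurable]: "tree_rays u \<in> sets M"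
proof -
  have [measurable]: "Measurable.pred M (\<lambda>\<omega>. bd_prefix m \<omega> \<in> tree_ray_words u m)" for m
    by (rule pred_prefix)
  show ?thesis unfolding tree_rays_def by measurable
qed

section \<open>The Poincare series on tree rays\<close>

definition jacobian :: "'a letter list \<Rightarrow> (nat \<Rightarrow> 'a letter) \<Rightarrow> ennreal" where
  "jacobian h \<omega> = ennreal (q powi (- busemann \<omega> h))"

lemma measurable_jacobian [measurable]: "h \<in> H \<Longrightarrow> jacobian h \<in> borel_measurable M"
  unfolding jacobian_def[abs_def]
  by (rule measurable_compose[OF measurable_busemann[OF H_reduced]]) simp_all

text \<open>Cover the tree rays by cylinders longer than all elements of \<open>K\<close>. There
  each Jacobian is constant, and its integral is the weight of the translated cylinder.\<close>

lemma integral_jacobian_le_1: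
  assumes K: "finite K" "K \<subseteq> H"
  shows "(\<integral>\<^sup>+\<omega>. (\<Sum>h\<in>K. jacobian h \<omega> * indicator (tree_rays u) \<omega>) \<partial>M) \<le> 1"
proof -
  \<comment> \<open>Any common bound on the lengths serves; the sum also covers empty
    \<open>K\<close>.\<close>
  define L where "L = (\<Sum>h\<in>K. length h)"
  have L: "length h \<le> L" if "h \<in> K" for h
    unfolding L_def using K that by (intro member_le_sum) auto
  define m where "m = Suc (length u + 3 * L)"
  let ?W = "tree_ray_words u m"
  have finW: "finite ?W"
    by (rule finite_subset[OF _ finite_words[of m]]) (auto simp: tree_ray_words_def)
  have le: "jacobian h \<omega> * indicator (tree_rays u) \<omega> \<le> (\<Sum>w\<in>?W. jacobian h \<omega> * indicator (cylinder w) \<omega>)"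
    if "\<omega> \<in> space M" for h \<omega>
  proof (cases "\<omega> \<in> tree_rays u")
    case True
    then have "bd_prefix m \<omega> \<in> ?W" by (auto simp: tree_rays_def m_def)
    moreover have "\<omega> \<in> cylinder (bd_prefix m \<omega>)" using that by (simp add: cylinder_eq space_M)
    ultimately show ?thesis
      using member_le_sum[of "bd_prefix m \<omega>" ?W "\<lambda>w. jacobian h \<omega> * indicator (cylinder w) \<omega>"] finW True
      by simp
  qed simp
  have int: "(\<integral>\<^sup>+\<omega>. jacobian h \<omega> * indicator (cylinder w) \<omega> \<partial>M) = ennreal (weight (freely_reduce (inv_word h @ w)))"
    if "h \<in> K" "w \<in> ?W" for h w
  proof -
    have w: "reduced_word w" "length w = m" using that by (auto simp: tree_ray_words_def words_def)
    have hH: "h \<in> H" using that K by auto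
    have hw: "length h < length w" using L[OF that(1)] w by (simp add: m_def)
    have "w \<noteq> []" using hw by auto
    then have wpos: "weight w > 0" using weight_eq[OF w(1)] q_ge_3 by simp
    \<comment> \<open>Positive weight provides a point of the cylinder at which the constant value
      of the Jacobian is evaluated.\<close>
    then obtain \<omega>0 where \<omega>0: "\<omega>0 \<in> cylinder w" by (force simp: weight_def)
    have "jacobian h \<omega> = jacobian h \<omega>0" if "\<omega> \<in> cylinder w" for \<omega>
    proof -
      have "q powi (- busemann \<omega> h) * weight w = q powi (- busemann \<omega>0 h) * weight w"
        using weight_translate[OF that hH w(1) hw] weight_translate[OF \<omega>0 hH w(1) hw] by simp
      then have "q powi (- busemann \<omega> h) = q powi (- busemann \<omega>0 h)" using wpos by simp
      then show ?thesis unfolding jacobian_def by (rule arg_cong)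
    qed
    then have "jacobian h \<omega> * indicator (cylinder w) \<omega> = jacobian h \<omega>0 * indicator (cylinder w) \<omega>" for \<omega>
      by (cases "\<omega> \<in> cylinder w") simp_all
    then have "(\<integral>\<^sup>+\<omega>. jacobian h \<omega> * indicator (cylinder w) \<omega> \<partial>M) = jacobian h \<omega>0 * emeasure M (cylinder w)"
      by (simp add: nn_integral_cmult_indicator)
    also have "\<dots> = ennreal (q powi (- busemann \<omega>0 h) * weight w)"
      using q_ge_3 by (simp add: jacobian_def emeasure_eq_measure weight_def ennreal_mult)
    finally show ?thesis by (simp only: weight_translate[OF \<omega>0 hH w(1) hw])
  qed
  have [measurable]: "h \<in> K \<Longrightarrow> jacobian h \<in> borel_measurable M" for h using K by auto
  have "(\<integral>\<^sup>+\<omega>. (\<Sum>h\<in>K. jacobian h \<omega> * indicator (tree_rays u) \<omega>) \<partial>M) \<le>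
      (\<integral>\<^sup>+\<omega>. (\<Sum>h\<in>K. \<Sum>w\<in>?W. jacobian h \<omega> * indicator (cylinder w) \<omega>) \<partial>M)"
    by (intro nn_integral_mono sum_mono le)
  also have "\<dots> = (\<Sum>h\<in>K. \<Sum>w\<in>?W. \<integral>\<^sup>+\<omega>. jacobian h \<omega> * indicator (cylinder w) \<omega> \<partial>M)"
    by (simp add: nn_integral_sum)
  also have "\<dots> = (\<Sum>h\<in>K. \<Sum>w\<in>?W. ennreal (weight (freely_reduce (inv_word h @ w))))"
    by (intro sum.cong refl int)
  also have "\<dots> = ennreal (\<Sum>(h, w)\<in>K \<times> ?W. weight (freely_reduce (inv_word h @ w)))"
    by (simp add: sum.cartesian_product' sum_nonneg)
  also have "\<dots> \<le> 1"
    using sum_translates_le_1[OF K L, of u m] by (simp add: m_def)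
  finally show ?thesis .
qed

lemma poincare_divergence_iff:
  "\<omega> \<in> poincare_divergence H \<longleftrightarrow> \<omega> \<in> space M \<and> (\<Sum>\<^sub>\<infinity>h\<in>H. jacobian h \<omega>) = \<infinity>"
  by (simp add: poincare_divergence_def jacobian_def q_def space_M)

lemma measurable_poincare_sum [measurable]: "(\<lambda>\<omega>. \<Sum>\<^sub>\<infinity>h\<in>H. jacobian h \<omega>) \<in> borel_measurable M"
  unfolding infsum_ennreal_SUP_nat
  by (intro borel_measurable_SUP borel_measurable_sum) auto

text \<open>Exhausting \<open>H\<close> by finite sets and passing to the limit, the integral of the
  series over the tree rays is at most one, so the series is finite almost everywhere there.\<close>

lemma tree_rays_not_poincare: "AE \<omega> in M. \<omega> \<in> tree_rays u \<longrightarrow> \<omega> \<notin> poincare_divergence H"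
proof -
  define K where "K n = {h\<in>H. to_nat h < n}" for n
  have finK: "finite (K n)" for n unfolding K_def
    by (rule finite_subset[OF _ finite_vimageI[OF finite_lessThan[of n] inj_to_nat]]) auto
  have KH: "K n \<subseteq> H" for n by (auto simp: K_def)
  let ?f = "\<lambda>n \<omega>. \<Sum>h\<in>K n. jacobian h \<omega> * indicator (tree_rays u) \<omega>"
  have meas: "?f n \<in> borel_measurable M" for n
    using KH[of n] by (intro borel_measurable_sum) auto
  have inc: "incseq ?f"
  proof (rule incseq_SucI)
    fix n show "?f n \<le> ?f (Suc n)"
      unfolding le_fun_def using finK by (intro allI sum_mono2) (auto simp: K_def)
  qed
  have "(\<integral>\<^sup>+\<omega>. (SUP n. ?f n \<omega>) \<partial>M) = (SUP n. \<integral>\<^sup>+\<omega>. ?f n \<omega> \<partial>M)"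
    by (rule nn_integral_monotone_convergence_SUP[OF inc meas])
  also have "\<dots> \<le> 1" by (intro SUP_least integral_jacobian_le_1 finK KH)
  finally have "(\<integral>\<^sup>+\<omega>. (SUP n. ?f n \<omega>) \<partial>M) \<noteq> \<infinity>" by (auto simp: top_unique)
  then have "AE \<omega> in M. (SUP n. ?f n \<omega>) \<noteq> \<infinity>"
    by (intro nn_integral_PInf_AE borel_measurable_SUP meas) auto
  then show ?thesis
    by eventually_elim (auto simp: poincare_divergence_iff infsum_ennreal_SUP_nat K_def)
qed

lemma tree_rays_cover:
  assumes \<omega>: "\<omega> \<in> boundary" "\<omega> \<notin> schreier_limit_set H T"
  obtains u where "\<omega> \<in> tree_rays u"
proof -
  have "\<omega> \<notin> small_horospheric H" using \<omega> small_horospheric_subset_schreier by auto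
  then obtain N1 where N1: "\<And>n. n \<ge> N1 \<Longrightarrow>
      height (walk H (bd_prefix (Suc n) \<omega>)) = Suc (height (walk H (bd_prefix n \<omega>)))"
    using eventually_outward[OF \<omega>(1)] by blast
  have "finite (crossings \<omega>)" using \<omega> by (simp add: schreier_limit_set_eq)
  then obtain N2 where N2: "\<forall>i\<in>crossings \<omega>. i < N2" unfolding finite_nat_set_iff_bounded by blast
  \<comment> \<open>From this time on the path is outward and has no crossings.\<close>
  define N where "N = max N1 N2"
  have out: "outward N (bd_prefix m \<omega>)" for m
    using N1 by (intro outward_bd_prefix) (simp add: N_def)
  have cr: "word_crossings N (bd_prefix m \<omega>) = {}" for m
  proof -
    have "i \<notin> word_crossings N (bd_prefix m \<omega>)" for i
      using N2 crossings_bd_prefix[of i m N \<omega>] by (force simp: word_crossings_def N_def)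
    then show ?thesis by blast
  qed
  have "\<omega> \<in> tree_rays (bd_prefix N \<omega>)"
    using \<omega> out cr reduced_bd_prefix
    by (auto simp: tree_rays_def tree_ray_words_def words_def space_M)
  then show thesis by (rule that)
qed

text \<open>There are only countably many initial words \<open>u\<close>, so the exceptional sets
  together remain null.\<close>

lemma poincare_divergence_AE_schreier:
  "AE \<omega> in M. \<omega> \<in> poincare_divergence H \<longrightarrow> \<omega> \<in> schreier_limit_set H T"
proof -
  have "AE \<omega> in M. \<forall>u. \<omega> \<in> tree_rays u \<longrightarrow> \<omega> \<notin> poincare_divergence H"
    unfolding AE_all_countable using tree_rays_not_poincare by blast
  then show ?thesis
  proof eventually_elim
    case (elim \<omega>)
    then show ?case using tree_rays_cover[of \<omega>] by (auto simp: poincare_divergence_def)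
  qed
qed

section \<open>Measurability of the four sets and conclusion\<close>

lemma sets_schreier_limit_set: "schreier_limit_set H T \<in> sets M"
  unfolding schreier_limit_set_eq space_M[symmetric] using pred_infinite_crossings by measurable

lemma sets_small_horospheric: "small_horospheric H \<in> sets M"
proof -
  have [measurable]: "Measurable.pred M (\<lambda>\<omega>. defect \<omega> n > C)" for n C
    unfolding defect_def by (rule pred_prefix)
  have "small_horospheric H = {\<omega> \<in> space M. \<forall>C. \<exists>n. defect \<omega> n > C}"
    using small_horospheric_iff by (auto simp: space_M small_horospheric_def)
  then show ?thesis by simp
qed

lemma sets_big_horospheric: "big_horospheric H \<in> sets M"
proof -
  \<comment> \<open>Membership and reducedness are part of the predicate, so that the quantifiers
    below range over the countable type of all words.\<close>
  have "Measurable.pred M (\<lambda>\<omega>. h \<in> H \<and> n \<le> to_nat h \<and> reduced_word g \<and> busemann \<omega> h \<le> busemann \<omega> g)"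
    for n :: nat and h g
  proof (cases "h \<in> H \<and> reduced_word g")
    case True
    note [measurable] = measurable_busemann[OF H_reduced, of h] measurable_busemann[of g]
    show ?thesis using True by simp
  qed auto
  then have pred: "Measurable.pred M (\<lambda>\<omega>. \<exists>g. \<forall>n. \<exists>h. h \<in> H \<and> n \<le> to_nat h \<and> reduced_word g \<and>
      busemann \<omega> h \<le> busemann \<omega> g)"
    by measurable
  have inf: "infinite (H \<inter> horoball \<omega> g) \<longleftrightarrow>
      (\<forall>n. \<exists>h. h \<in> H \<and> n \<le> to_nat h \<and> busemann \<omega> h \<le> busemann \<omega> g)" for \<omega> g
  proof -
    have "h \<in> H \<inter> horoball \<omega> g \<longleftrightarrow> h \<in> H \<and> busemann \<omega> h \<le> busemann \<omega> g" for h
      using H_reduced[of h] by (auto simp: horoball_def)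
    then show ?thesis unfolding infinite_iff_to_nat_unbounded Bex_def by blast
  qed
  have "big_horospheric H = {\<omega> \<in> space M. \<exists>g. \<forall>n. \<exists>h. h \<in> H \<and> n \<le> to_nat h \<and> reduced_word g \<and>
      busemann \<omega> h \<le> busemann \<omega> g}"
  proof -
    have "reduced_word g \<and> infinite (H \<inter> horoball \<omega> g) \<longleftrightarrow> (\<forall>n. \<exists>h. h \<in> H \<and> n \<le> to_nat h \<and>
        reduced_word g \<and> busemann \<omega> h \<le> busemann \<omega> g)" for \<omega> g
      unfolding inf by (cases "reduced_word g") simp_all
    then show ?thesis by (simp only: big_horospheric_def space_M Bex_def free_group_simps)
  qed
  then show ?thesis using predE[OF pred] by (simp only:)
qed

lemma sets_poincare_divergence: "poincare_divergence H \<in> sets M"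
proof -
  have "poincare_divergence H = {\<omega> \<in> space M. (\<Sum>\<^sub>\<infinity>h\<in>H. jacobian h \<omega>) = \<infinity>}"
    using poincare_divergence_iff by blast
  then show ?thesis by simp
qed

text \<open>The small horospheric set lies in the big one, which lies in the divergence set. Almost
  everywhere the latter lies in the Schreier limit set, and this in the small horospheric set, which
  closes the cycle.\<close>

lemma limit_sets_AE_eq:
  assumes "A \<in> {small_horospheric H, schreier_limit_set H T, big_horospheric H, poincare_divergence H}"
    and "B \<in> {small_horospheric H, schreier_limit_set H T, big_horospheric H, poincare_divergence H}"
  shows "sym_diff A B \<in> null_sets M"
proof -
  have "sym_diff A B \<in> sets M"
    using assms sets_schreier_limit_set sets_small_horospheric sets_big_horospheric
      sets_poincare_divergence by auto
  moreover have "AE \<omega> in M. \<omega> \<notin> sym_diff A B"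
    using schreier_limit_set_AE_small poincare_divergence_AE_schreier
  proof eventually_elim
    case (elim \<omega>)
    then show ?case
      using assms small_horospheric_subset_big[of H] big_horospheric_subset_poincare[of H]
        small_horospheric_subset_schreier by blast
  qed
  ultimately show ?thesis by (simp add: AE_iff_null_sets)
qed

end

theorem theorem3p21:
  fixes H :: "'a::finite letter list set"
    and T :: "'a edge set"
    and M :: "(nat \<Rightarrow> 'a letter) measure"
  assumes "CARD('a) \<ge> 2"
    and "subgroup H free_group" and "H \<noteq> {\<one>\<^bsub>free_group\<^esub>}"
    and "geodesic_spanning_tree H T"
    and "uniform_measure_on_boundary M"
  shows "\<forall>A \<in> {small_horospheric H, schreier_limit_set H T, big_horospheric H,
                poincare_divergence H}.
         \<forall>B \<in> {small_horospheric H, schreier_limit_set H T, big_horospheric H,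
                poincare_divergence H}.
           sym_diff A B \<in> null_sets M"
proof -
  interpret schreier_boundary H T M
    by (intro schreier_boundary.intro schreier_tree.intro schreier_tree_axioms.intro
        schreier.intro boundary_measure.intro assms)
  show ?thesis using limit_sets_AE_eq by blast
qed

end
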